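(* Let $F$ be a field and $A$ a unital $F$-algebra of countable dimension. Then $A$ is linear sofic if and only if $SR(A)=0$.
   Context: For $a\in M_n(F)$, $\rho(a)=\operatorname{rk}(a)/n$; for a non-principal ultrafilter $\omega$ on $\mathbb{N}$ and $n_k\to\infty$, $\prod_{k\to\omega}M_{n_k}(F)/\operatorname{Ker}\rho_\omega$ is the quotient of $\prod_kM_{n_k}(F)$ by the ideal of sequences with $\lim_{k\to\omega}\rho(a_k)=0$. $A$ is linear sofic if there is an injective unital algebra morphism $A\to\prod_{k\to\omega}M_{n_k}(F)/\operatorname{Ker}\rho_\omega$ for some such $\omega,(n_k)$. For a finite-dimensional subspace $L\subseteq A$ with $1\in L$ and $\varepsilon>0$, an $\varepsilon$-almost representation of $L$ is a linear map $\psi:L\to\operatorname{End}_F(V)$, $V$ a finite-dimensional $F$-vector space, with $\psi(1)=\mathrm{Id}$, such that there is a subspace $V_\varepsilon\subseteq V$ with $\dim V-\dim V_\varepsilon<\varepsilon\dim V$ and $\psi(a)\psi(b)v=\psi(ab)v$ for all $a,b\in L$ with $ab\in L$ and all $v\in V_\varepsilon$. $A$ has almost finite dimensional representations if every such $L$ has an $\varepsilon$-almost representation for every $\varepsilon>0$. The sofic radical $SR(A)$: if $A$ does not have almost finite dimensional representations, $SR(A)=A$; otherwise $p\in SR(A)$ iff for every $\delta>0$ there exist a finite-dimensional subspace $L$ with $\{1,p\}\subseteq L\subseteq A$ and $\eta>0$ such that for every $0<\varepsilon<\eta$ and every $\varepsilon$-almost representation $\psi:L\to\operatorname{End}_F(V)$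 one has $\dim\operatorname{Ran}\psi(p)<\delta\dim V$. *)

theory Defs
  imports Complex_Main "HOL-Library.Countable_Set" "Jordan_Normal_Form.DL_Rank"
begin

text \<open>A unital F-algebra: the ring structure comes from the type class ring_1
  (which includes 0 \<noteq> 1), the F-vector space structure from the scalar multiplication
  scale, required to be bilinear with respect to the ring multiplication.\<close>
definition f_algebra :: "('f::field \<Rightarrow> 'a::ring_1 \<Rightarrow> 'a) \<Rightarrow> bool" where
  "f_algebra scale \<longleftrightarrow> vector_space scale \<and>
     (\<forall>c x y. scale c (x * y) = scale c x * y \<and> scale c (x * y) = x * scale c y)"

definition countable_dim :: "('f::field \<Rightarrow> 'a::ring_1 \<Rightarrow> 'a) \<Rightarrow> bool" where
  "countable_dim scale \<longleftrightarrow>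
     (\<exists>B. countable B \<and> \<not> module.dependent scale B \<and> module.span scale B = UNIV)"

definition rho :: "'f::field mat \<Rightarrow> real" where
  "rho M = real (vec_space.rank (dim_row M) M) / real (dim_row M)"

definition nonprincipal_ultrafilter :: "nat filter \<Rightarrow> bool" where
  "nonprincipal_ultrafilter \<omega> \<longleftrightarrow> \<omega> \<noteq> bot \<and>
     (\<forall>P. eventually P \<omega> \<or> eventually (\<lambda>x. \<not> P x) \<omega>) \<and>
     (\<forall>k. eventually (\<lambda>x. x \<noteq> k) \<omega>)"

definition in_ker_rho :: "nat filter \<Rightarrow> (nat \<Rightarrow> 'f::field mat) \<Rightarrow> bool" where
  "in_ker_rho \<omega> x \<longleftrightarrow> ((\<lambda>k. rho (x k)) \<longlongrightarrow> 0) \<omega>"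

text \<open>Linear soficity: an injective unital algebra morphism
  A \<rightarrow> prod_{k\<rightarrow>\<omega>} M_{n_k}(F) / Ker rho_omega, written via a lift
  phi : A \<rightarrow> prod_k M_{n_k}(F) which is a unital algebra morphism modulo Ker rho_omega
  and whose kernel modulo Ker rho_omega is {0}.\<close>
definition linear_sofic :: "('f::field \<Rightarrow> 'a::ring_1 \<Rightarrow> 'a) \<Rightarrow> bool" where
  "linear_sofic scale \<longleftrightarrow>
     (\<exists>\<omega> (n::nat \<Rightarrow> nat) (\<phi>::'a \<Rightarrow> nat \<Rightarrow> 'f mat).
        nonprincipal_ultrafilter \<omega> \<and> filterlim n at_top sequentially \<and>
        (\<forall>a k. \<phi> a k \<in> carrier_mat (n k) (n k)) \<and>
        in_ker_rho \<omega> (\<lambda>k. \<phi> 1 k - 1\<^sub>m (n k)) \<and>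
        (\<forall>a b. in_ker_rho \<omega> (\<lambda>k. \<phi> (a + b) k - (\<phi> a k + \<phi> b k))) \<and>
        (\<forall>c a. in_ker_rho \<omega> (\<lambda>k. \<phi> (scale c a) k - c \<cdot>\<^sub>m \<phi> a k)) \<and>
        (\<forall>a b. in_ker_rho \<omega> (\<lambda>k. \<phi> (a * b) k - \<phi> a k * \<phi> b k)) \<and>
        (\<forall>a. in_ker_rho \<omega> (\<phi> a) \<longrightarrow> a = 0))"

definition fin_dim_subspace :: "('f::field \<Rightarrow> 'a::ring_1 \<Rightarrow> 'a) \<Rightarrow> 'a set \<Rightarrow> bool" where
  "fin_dim_subspace scale L \<longleftrightarrow> (\<exists>B. finite B \<and> L = module.span scale B)"

text \<open>An eps-almost representation psi : L \<rightarrow> End_F(V), with V = F^m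
  (any finite-dimensional V is isomorphic to some F^m); endomorphisms are m x m matrices.\<close>
definition almost_rep ::
  "('f::field \<Rightarrow> 'a::ring_1 \<Rightarrow> 'a) \<Rightarrow> 'a set \<Rightarrow> real \<Rightarrow> nat \<Rightarrow> ('a \<Rightarrow> 'f mat) \<Rightarrow> bool" where
  "almost_rep scale L \<epsilon> m \<psi> \<longleftrightarrow>
     (\<forall>a\<in>L. \<psi> a \<in> carrier_mat m m) \<and>
     (\<forall>a\<in>L. \<forall>b\<in>L. \<psi> (a + b) = \<psi> a + \<psi> b) \<and>
     (\<forall>c. \<forall>a\<in>L. \<psi> (scale c a) = c \<cdot>\<^sub>m \<psi> a) \<and>
     \<psi> 1 = 1\<^sub>m m \<and>
     (\<exists>W. subspace (class_ring :: 'f ring) W (module_vec TYPE('f) m) \<and>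
        real m - real (vectorspace.dim (class_ring :: 'f ring) ((module_vec TYPE('f) m)\<lparr>carrier := W\<rparr>))
          < \<epsilon> * real m \<and>
        (\<forall>a\<in>L. \<forall>b\<in>L. a * b \<in> L \<longrightarrow>
           (\<forall>v\<in>W. \<psi> a *\<^sub>v (\<psi> b *\<^sub>v v) = \<psi> (a * b) *\<^sub>v v)))"

definition has_afd_reps :: "('f::field \<Rightarrow> 'a::ring_1 \<Rightarrow> 'a) \<Rightarrow> bool" where
  "has_afd_reps scale \<longleftrightarrow>
     (\<forall>L. fin_dim_subspace scale L \<and> 1 \<in> L \<longrightarrow>
        (\<forall>\<epsilon>>0. \<exists>m \<psi>. almost_rep scale L \<epsilon> m \<psi>))"

definition sofic_radical :: "('f::field \<Rightarrow> 'a::ring_1 \<Rightarrow> 'a) \<Rightarrow> 'a set" where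
  "sofic_radical scale =
     (if \<not> has_afd_reps scale then UNIV
      else {p. \<forall>\<delta>>0. \<exists>L \<eta>. fin_dim_subspace scale L \<and> 1 \<in> L \<and> p \<in> L \<and> \<eta> > 0 \<and>
               (\<forall>\<epsilon> m \<psi>. 0 < \<epsilon> \<and> \<epsilon> < \<eta> \<and> almost_rep scale L \<epsilon> m \<psi> \<longrightarrow>
                  real (vec_space.rank m (\<psi> p :: 'f mat)) < \<delta> * real m)})"

end

theory Submission
  imports Defs
begin

text \<open>
  Throughout, a subspace of \<open>F\<^sup>m\<close> is represented by a matrix with trivial kernel whose columns
  span it; a \<open>\<epsilon>\<close>-almost representation then amounts to such a matrix \<open>Q\<close> with
  \<open>\<psi> a * \<psi> b * Q = \<psi> (a * b) * Q\<close>, and all estimates are rank inequalities.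

  If the algebra is linear sofic and \<open>L\<close> is finite-dimensional, the \<open>k\<close>-th component of the
  morphism, made linear by prescribing it on a basis, is an almost representation of \<open>L\<close> for most
  \<open>k\<close>, and it takes \<open>p\<close> to a matrix of rank ratio close to that of \<open>\<phi> p k\<close>. Hence \<open>p\<close> in the
  sofic radical lies in the kernel.

  Conversely, exhaust the algebra by finite-dimensional spaces \<open>L k\<close>. Every \<open>p\<close> outside the
  radical yields almost representations of all \<open>L k\<close> that stay away from zero at \<open>p\<close>; the elements
  on which these tend to zero form a subspace \<open>N p\<close> not containing \<open>p\<close>. Since each \<open>L k\<close> is
  finite-dimensional, countably many of the \<open>N p\<close> already intersect in zero. Direct sums of the
  corresponding almost representations with weights \<open>2 ^ - (i + 1)\<close>, realised by taking
  multiplicities, give a morphism with trivial kernel.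
\<close>

section \<open>Rank of matrices and subspaces\<close>

text \<open>A subspace given by a basis as columns: restricting \<open>A\<close> to it is the
  product \<open>A * Q\<close>, so agreement of two maps on the subspace becomes one matrix
  equation.\<close>

definition inj_mat :: "'f::field mat \<Rightarrow> nat \<Rightarrow> nat \<Rightarrow> bool" where
  "inj_mat Q m d \<longleftrightarrow> Q \<in> carrier_mat m d \<and>
     (\<forall>v\<in>carrier_vec d. Q *\<^sub>v v = 0\<^sub>v m \<longrightarrow> v = 0\<^sub>v d)"

lemma inj_mat_carrier: "inj_mat Q m d \<Longrightarrow> Q \<in> carrier_mat m d"
  by (simp add: inj_mat_def)

lemma inj_matD: "inj_mat Q m d \<Longrightarrow> v \<in> carrier_vec d \<Longrightarrow> Q *\<^sub>v v = 0\<^sub>v m \<Longrightarrow> v = 0\<^sub>v d"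
  by (simp add: inj_mat_def)

lemma mult_unit_vec_col:
  assumes "A \<in> carrier_mat m (d::nat)" "i < d"
  shows "(A :: 'f::field mat) *\<^sub>v unit_vec d i = col A i"
proof (rule eq_vecI)
  fix j assume "j < dim_vec (col A i)"
  then have "j < m" using assms by simp
  then show "(A *\<^sub>v unit_vec d i) $ j = col A i $ j"
    using assms scalar_prod_right_unit[of i d "row A j"] by auto
qed (use assms in auto)

text \<open>Two equal columns would put a difference of unit vectors into the kernel. Linear
  dependence is stated for the set of columns, so repetitions have to be excluded
  separately.\<close>

lemma distinct_cols_inj_mat:
  assumes "inj_mat (Q :: 'f::field mat) m d" shows "distinct (cols Q)"
proof -
  have Q: "Q \<in> carrier_mat m d" using assms by (simp add: inj_mat_def)
  have "i = j" if ij: "i < d" "j < d" and eq: "col Q i = col Q j" for i j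
  proof (rule ccontr)
    assume ne: "i \<noteq> j"
    have "Q *\<^sub>v (unit_vec d i - unit_vec d j) = Q *\<^sub>v unit_vec d i - Q *\<^sub>v unit_vec d j"
      using Q by (intro mult_minus_distrib_mat_vec) auto
    also have "\<dots> = 0\<^sub>v m"
      using Q ij eq by (auto simp: mult_unit_vec_col[OF Q] col_dim)
    finally have "unit_vec d i - unit_vec d j = (0\<^sub>v d :: 'f vec)"
      using assms by (intro inj_matD[OF assms]) auto
    then have "(unit_vec d i - unit_vec d j) $ i = (0\<^sub>v d :: 'f vec) $ i" by simp
    then show False using ij ne by simp
  qed
  then show ?thesis using Q by (auto simp: distinct_conv_nth)
qed

lemma lin_indpt_cols_inj_mat:
  assumes "inj_mat (Q :: 'f::field mat) m d"
  shows "\<not> module.lin_dep (class_ring :: 'f ring) (module_vec TYPE('f) m) (set (cols Q))"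
proof -
  interpret vec_space "TYPE('f)" m .
  show ?thesis
  proof
    assume "lin_dep (set (cols Q))"
    then obtain v where "v \<in> carrier_vec d" "v \<noteq> 0\<^sub>v d" "Q *\<^sub>v v = 0\<^sub>v m"
      using lin_depE[OF inj_mat_carrier[OF assms] _ distinct_cols_inj_mat[OF assms]] by blast
    then show False using inj_matD[OF assms] by blast
  qed
qed

lemma rank_inj_mat:
  assumes "inj_mat (Q :: 'f::field mat) m d" shows "vec_space.rank m Q = d"
  using vec_space.lin_indpt_full_rank[OF inj_mat_carrier[OF assms] distinct_cols_inj_mat[OF assms]
      lin_indpt_cols_inj_mat[OF assms]] .

lemma inj_mat_of_lin_indpt:
  assumes "finite U" "U \<subseteq> carrier_vec m"
    "\<not> module.lin_dep (class_ring :: 'f::field ring) (module_vec TYPE('f) m) U"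
  obtains Q where "inj_mat (Q :: 'f mat) m (card U)" "set (cols Q) = U"
proof -
  interpret vec_space "TYPE('f)" m .
  obtain xs where xs: "set xs = U" "distinct xs" using finite_distinct_list[OF assms(1)] by blast
  define Q where "Q = mat_of_cols m xs"
  have len: "length xs = card U" using xs distinct_card by fastforce
  have Q: "Q \<in> carrier_mat m (card U)" unfolding Q_def len[symmetric] by simp
  have cols: "cols Q = xs" unfolding Q_def using xs assms by (intro cols_mat_of_cols) auto
  have "inj_mat Q m (card U)" unfolding inj_mat_def
  proof (intro conjI ballI impI Q)
    fix v assume "v \<in> carrier_vec (card U)" "Q *\<^sub>v v = 0\<^sub>v m"
    then show "v = 0\<^sub>v (card U)" using lin_depI[OF Q, of v] cols xs assms(3) by auto
  qed
  then show ?thesis using that cols xs by blast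
qed

text \<open>Independent sets in \<open>F^m\<close> have at most \<open>m\<close> elements, so
  \<open>W\<close> contains a maximal one, and maximality makes it span \<open>W\<close>.
  Finite-dimensionality is recorded along with the cardinality because comparing dimensions of
  nested subspaces relies on it.\<close>

lemma fin_dim_subspace_vec:
  assumes W: "subspace (class_ring :: 'f::field ring) W (module_vec TYPE('f) m)"
  obtains U where "finite U" "U \<subseteq> W"
    "\<not> module.lin_dep (class_ring :: 'f ring) (module_vec TYPE('f) m) U"
    "card U = vectorspace.dim (class_ring :: 'f ring) ((module_vec TYPE('f) m)\<lparr>carrier := W\<rparr>)"
    "vectorspace.fin_dim (class_ring :: 'f ring) ((module_vec TYPE('f) m)\<lparr>carrier := W\<rparr>)"
proof -
  interpret vec_space "TYPE('f)" m .
  have sub: "submodule class_ring W V" using W by (simp add: subspace_def)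
  have Wc: "W \<subseteq> carrier_vec m" using sub by (auto simp: submodule_def)
  have "\<And>T. T \<subseteq> W \<and> lin_indpt T \<Longrightarrow> finite T \<and> card T \<le> m"
    using li_le_dim[OF fin_dim] Wc dim_is_n by auto
  then obtain U where U: "finite U" "maximal U (\<lambda>T. T \<subseteq> W \<and> lin_indpt T)"
    using maximal_exists[of "\<lambda>T. T \<subseteq> W \<and> lin_indpt T" m "{}"] finite_lin_indpt2[of "{}"]
    by auto
  then have UW: "U \<subseteq> W" and li: "lin_indpt U" by (auto simp: maximal_def)
  have Uc: "U \<subseteq> carrier_vec m" using UW Wc by blast
  have sp: "span U = W"
  proof
    show "span U \<subseteq> W" using span_is_subset[OF UW sub] .
    show "W \<subseteq> span U"
    proof (rule ccontr)
      assume "\<not> W \<subseteq> span U"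
      then obtain s where s: "s \<in> W" "s \<notin> span U" by blast
      have "s \<notin> U" using s span_mem Uc by auto
      moreover have "lin_indpt (U \<union> {s})"
        using lin_dep_iff_in_span[of U s] s Uc Wc li \<open>s \<notin> U\<close> by auto
      ultimately show False using U(2) UW s unfolding maximal_def
        by (metis Un_insert_right insertI1 insert_subset subset_insertI sup_bot_right)
    qed
  qed
  have vsW: "vectorspace class_ring (vs W)" using subspace_is_vs[OF W] .
  have b: "vectorspace.basis class_ring (vs W) U"
    using vectorspace.basis_def[OF vsW] span_li_not_depend[OF UW sub] sp li UW by auto
  then have "card U = vectorspace.dim class_ring (vs W)"
    using vectorspace.dim_basis[OF vsW U(1)] by simp
  moreover have "vectorspace.fin_dim class_ring (vs W)"
    using b vectorspace.basis_def[OF vsW] vectorspace.fin_dim_def[OF vsW] U(1) by blast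
  ultimately show ?thesis using that U UW li by blast
qed

lemma subspace_vec_obtain_inj_mat:
  assumes "subspace (class_ring :: 'f::field ring) W (module_vec TYPE('f) m)"
  obtains Q where "inj_mat (Q :: 'f mat) m
      (vectorspace.dim (class_ring :: 'f ring) ((module_vec TYPE('f) m)\<lparr>carrier := W\<rparr>))"
    "set (cols Q) \<subseteq> W"
proof -
  obtain U where U: "finite U" "U \<subseteq> W"
    "\<not> module.lin_dep (class_ring :: 'f ring) (module_vec TYPE('f) m) U"
    "card U = vectorspace.dim (class_ring :: 'f ring) ((module_vec TYPE('f) m)\<lparr>carrier := W\<rparr>)"
    using fin_dim_subspace_vec[OF assms] by metis
  have "U \<subseteq> carrier_vec m" using assms U by (auto simp: subspace_def submodule_def module_vec_simps)
  then show ?thesis using inj_mat_of_lin_indpt[OF U(1) _ U(3)] U that by metis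
qed

section \<open>Rank-nullity and rank inequalities\<close>

lemma span_cols_eq_image:
  assumes "A \<in> carrier_mat m d"
  shows "LinearCombinations.module.span (class_ring :: 'f::field ring) (module_vec TYPE('f) m) (set (cols A))
    = (\<lambda>v. A *\<^sub>v v) ` carrier_vec d"
proof -
  interpret vec_space "TYPE('f)" m .
  show ?thesis using col_space_eq[OF assms] assms unfolding col_space_def by auto
qed

text \<open>Rank-nullity for the map \<open>v\<close> to \<open>A *\<^sub>v v\<close>, whose image
  is the column span. The kernel is an explicit set, so that kernels of different matrices can be
  compared by inclusion.\<close>

lemma rank_add_ker_dim:
  assumes A: "(A :: 'f::field mat) \<in> carrier_mat m n"
  shows "vec_space.rank m A +
     vectorspace.dim (class_ring :: 'f ring) ((module_vec TYPE('f) n)\<lparr>carrier := {v \<in> carrier_vec n. A *\<^sub>v v = 0\<^sub>v m}\<rparr>) = n"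
    "subspace (class_ring :: 'f ring) {v \<in> carrier_vec n. A *\<^sub>v v = 0\<^sub>v m} (module_vec TYPE('f) n)"
proof -
  interpret N: vec_space "TYPE('f)" n .
  interpret M: vec_space "TYPE('f)" m .
  have lin: "linear_map (class_ring :: 'f ring) (module_vec TYPE('f) n) (module_vec TYPE('f) m) (\<lambda>v. A *\<^sub>v v)"
    unfolding linear_map_def mod_hom_def mod_hom_axioms_def LinearCombinations.module_hom_def
    using A N.vectorspace_axioms M.vectorspace_axioms N.module_axioms M.module_axioms
    by (auto simp: module_vec_simps class_ring_simps mult_add_distrib_mat_vec mult_mat_vec)
  interpret L: linear_map "class_ring :: 'f ring" "module_vec TYPE('f) n" "module_vec TYPE('f) m" "\<lambda>v. A *\<^sub>v v"
    by (rule lin)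
  have im: "L.im = M.span (set (cols A))"
    unfolding span_cols_eq_image[OF A] L.im_def by simp
  have ker: "L.ker = {v \<in> carrier_vec n. A *\<^sub>v v = 0\<^sub>v m}"
    unfolding L.ker_def by (simp add: module_vec_simps)
  show "vec_space.rank m A +
     vectorspace.dim (class_ring :: 'f ring) ((module_vec TYPE('f) n)\<lparr>carrier := {v \<in> carrier_vec n. A *\<^sub>v v = 0\<^sub>v m}\<rparr>) = n"
    using L.rank_nullity[OF N.fin_dim] N.dim_is_n unfolding im ker M.rank_def by simp
  show "subspace (class_ring :: 'f ring) {v \<in> carrier_vec n. A *\<^sub>v v = 0\<^sub>v m} (module_vec TYPE('f) n)"
    using L.kerT_is_subspace unfolding ker .
qed

lemma mat_mult_zero_of_cols:
  assumes "A \<in> carrier_mat m n" "(K :: 'f::field mat) \<in> carrier_mat n d"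
    "\<And>v. v \<in> set (cols K) \<Longrightarrow> A *\<^sub>v v = 0\<^sub>v m"
  shows "A * K = 0\<^sub>m m d"
proof (rule eq_matI)
  fix i j assume ij: "i < dim_row (0\<^sub>m m d :: 'f mat)" "j < dim_col (0\<^sub>m m d :: 'f mat)"
  then have "col K j \<in> set (cols K)" using assms(2) by (auto simp: cols_def)
  then have "(A *\<^sub>v col K j) $ i = 0" using assms(3) ij by simp
  then show "(A * K) $$ (i, j) = 0\<^sub>m m d $$ (i, j)" using ij assms by auto
qed (use assms in auto)

lemma obtain_kernel_mat:
  assumes A: "(A :: 'f::field mat) \<in> carrier_mat m n"
  obtains K d where "inj_mat K n d" "A * K = 0\<^sub>m m d" "vec_space.rank m A + d = n"
proof -
  note * = rank_add_ker_dim[OF A]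
  obtain K where K: "inj_mat K n (vectorspace.dim (class_ring :: 'f ring) ((module_vec TYPE('f) n)\<lparr>carrier := {v \<in> carrier_vec n. A *\<^sub>v v = 0\<^sub>v m}\<rparr>))"
    "set (cols K) \<subseteq> {v \<in> carrier_vec n. A *\<^sub>v v = 0\<^sub>v m}"
    using subspace_vec_obtain_inj_mat[OF *(2)] by blast
  show ?thesis
    using that[OF K(1) mat_mult_zero_of_cols[OF A inj_mat_carrier[OF K(1)]] *(1)] K(2) by blast
qed

lemma dim_le_of_subset_vec:
  assumes W: "subspace (class_ring :: 'f::field ring) W (module_vec TYPE('f) m)"
    and X: "subspace (class_ring :: 'f::field ring) X (module_vec TYPE('f) m)" and "X \<subseteq> W"
  shows "vectorspace.dim (class_ring :: 'f ring) ((module_vec TYPE('f) m)\<lparr>carrier := X\<rparr>)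
    \<le> vectorspace.dim (class_ring :: 'f ring) ((module_vec TYPE('f) m)\<lparr>carrier := W\<rparr>)"
proof -
  interpret vec_space "TYPE('f)" m .
  have "subspace class_ring X (vs W)" using nested_subspaces[OF W X assms(3)] .
  then show ?thesis
    using vectorspace.subspace_dim[OF subspace_is_vs[OF W], of X]
      fin_dim_subspace_vec[OF W] fin_dim_subspace_vec[OF X] by auto
qed

lemma subspace_image_mat:
  assumes "(A :: 'f::field mat) \<in> carrier_mat m n"
  shows "subspace (class_ring :: 'f::field ring) ((\<lambda>v. A *\<^sub>v v) ` carrier_vec n) (module_vec TYPE('f) m)"
proof -
  interpret vec_space "TYPE('f)" m .
  show ?thesis using span_is_subspace[of "set (cols A)"] cols_dim[of A] assms
    unfolding span_cols_eq_image[OF assms] by auto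
qed

lemma rank_eq_dim_image:
  assumes "(A :: 'f::field mat) \<in> carrier_mat m n"
  shows "vec_space.rank m A = vectorspace.dim (class_ring :: 'f ring)
     ((module_vec TYPE('f) m)\<lparr>carrier := (\<lambda>v. A *\<^sub>v v) ` carrier_vec n\<rparr>)"
  unfolding vec_space.rank_def span_cols_eq_image[OF assms] ..

text \<open>The image of the product lies in the image of \<open>A\<close>.\<close>

lemma rank_mult_le_left:
  assumes A: "(A :: 'f::field mat) \<in> carrier_mat m n" and B: "B \<in> carrier_mat n d"
  shows "vec_space.rank m (A * B) \<le> vec_space.rank m A"
proof -
  have AB: "A * B \<in> carrier_mat m d" using A B by simp
  have "(\<lambda>v. (A * B) *\<^sub>v v) ` carrier_vec d \<subseteq> (\<lambda>v. A *\<^sub>v v) ` carrier_vec n"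
    using assms by (auto simp: assoc_mult_mat_vec)
  then show ?thesis unfolding rank_eq_dim_image[OF A] rank_eq_dim_image[OF AB]
    by (rule dim_le_of_subset_vec[OF subspace_image_mat[OF A] subspace_image_mat[OF AB]])
qed

text \<open>The kernel of \<open>B\<close> lies in the kernel of the product, and both act on
  \<open>F^d\<close>; rank-nullity reverses the inequality.\<close>

lemma rank_mult_le_right:
  assumes A: "(A :: 'f::field mat) \<in> carrier_mat m n" and B: "B \<in> carrier_mat n d"
  shows "vec_space.rank m (A * B) \<le> vec_space.rank n B"
proof -
  have AB: "A * B \<in> carrier_mat m d" using A B by simp
  have z: "A *\<^sub>v 0\<^sub>v n = 0\<^sub>v m" using A by (intro eq_vecI) auto
  have "{v \<in> carrier_vec d. B *\<^sub>v v = 0\<^sub>v n} \<subseteq> {v \<in> carrier_vec d. (A * B) *\<^sub>v v = 0\<^sub>v m}"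
    using assms z by (auto simp: assoc_mult_mat_vec)
  from dim_le_of_subset_vec[OF rank_add_ker_dim(2)[OF AB] rank_add_ker_dim(2)[OF B] this]
  show ?thesis using rank_add_ker_dim(1)[OF AB] rank_add_ker_dim(1)[OF B] by linarith
qed

text \<open>A certificate for lower bounds on the rank: \<open>A\<close> is injective on an
  \<open>r\<close>-dimensional space of the form \<open>S\<close> applied to \<open>F^r\<close>.
  Such an \<open>S\<close> with \<open>r\<close> equal to the rank is supplied by
  \<open>obtain_rank_section\<close>.\<close>

lemma rank_ge_inj_mult:
  assumes "(A :: 'f::field mat) \<in> carrier_mat m n" "S \<in> carrier_mat n r" "inj_mat (A * S) m r"
  shows "r \<le> vec_space.rank m A"
  using rank_mult_le_left[OF assms(1,2)] rank_inj_mat[OF assms(3)] by simp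

text \<open>The image of \<open>Q\<close> is a \<open>d\<close>-dimensional subspace of the kernel
  of \<open>A\<close>.\<close>

lemma rank_add_le_of_mult_inj_zero:
  assumes A: "(A :: 'f::field mat) \<in> carrier_mat m n" and Q: "inj_mat Q n d" and "A * Q = 0\<^sub>m m d"
  shows "vec_space.rank m A + d \<le> n"
proof -
  have Qc: "Q \<in> carrier_mat n d" by (rule inj_mat_carrier[OF Q])
  have "(\<lambda>v. Q *\<^sub>v v) ` carrier_vec d \<subseteq> {v \<in> carrier_vec n. A *\<^sub>v v = 0\<^sub>v m}"
    using A Qc by (auto simp: assoc_mult_mat_vec[symmetric] assms(3))
  from dim_le_of_subset_vec[OF rank_add_ker_dim(2)[OF A] subspace_image_mat[OF Qc] this]
  have "d \<le> vectorspace.dim (class_ring :: 'f ring) ((module_vec TYPE('f) n)\<lparr>carrier := {v \<in> carrier_vec n. A *\<^sub>v v = 0\<^sub>v m}\<rparr>)"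
    unfolding rank_eq_dim_image[OF Qc, symmetric] rank_inj_mat[OF Q] .
  then show ?thesis using rank_add_ker_dim(1)[OF A] by linarith
qed

text \<open>The preceding bound for the zero matrix, which annihilates every
  \<open>Q\<close>.\<close>

lemma inj_mat_dim_le: assumes "inj_mat (Q :: 'f::field mat) m d" shows "d \<le> m"
proof -
  have "0\<^sub>m m m * Q = 0\<^sub>m m d" using inj_mat_carrier[OF assms] by simp
  from rank_add_le_of_mult_inj_zero[OF _ assms this] show ?thesis by simp
qed

text \<open>The columns of \<open>S\<close> are preimages under \<open>A\<close> of a basis of its
  image.\<close>

lemma obtain_rank_section:
  assumes A: "(A :: 'f::field mat) \<in> carrier_mat m n"
  obtains S where "S \<in> carrier_mat n (vec_space.rank m A)" "inj_mat (A * S) m (vec_space.rank m A)"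
proof -
  interpret vec_space "TYPE('f)" m .
  obtain Q where Q: "inj_mat (Q :: 'f mat) m (rank A)" "set (cols Q) \<subseteq> (\<lambda>v. A *\<^sub>v v) ` carrier_vec n"
    by (rule subspace_vec_obtain_inj_mat[OF subspace_image_mat[OF A],
        folded rank_eq_dim_image[OF A]])
  have Qc: "Q \<in> carrier_mat m (rank A)" using inj_mat_carrier[OF Q(1)] .
  have "\<forall>j<rank A. \<exists>v. v \<in> carrier_vec n \<and> A *\<^sub>v v = col Q j"
  proof (intro allI impI)
    fix j assume "j < rank A"
    then have "col Q j \<in> set (cols Q)" using Qc by (auto simp: cols_def)
    then have "col Q j \<in> (\<lambda>v. A *\<^sub>v v) ` carrier_vec n" using Q(2) by blast
    then show "\<exists>v. v \<in> carrier_vec n \<and> A *\<^sub>v v = col Q j" by auto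
  qed
  then obtain f where f: "\<And>j. j < rank A \<Longrightarrow> f j \<in> carrier_vec n \<and> A *\<^sub>v f j = col Q j" by metis
  define S where "S = mat_of_cols n (map f [0..<rank A])"
  have S: "S \<in> carrier_mat n (rank A)" unfolding S_def
    using mat_of_cols_carrier(1)[of n "map f [0..<rank A]"] by simp
  have colS: "col S j = f j" if "j < rank A" for j
    using that f[OF that] unfolding S_def by (subst col_mat_of_cols) auto
  have "A * S = Q"
  proof (rule eq_matI)
    fix i j assume "i < dim_row Q" "j < dim_col Q"
    then have ij: "i < m" "j < rank A" using Qc by auto
    then have "(A * S) $$ (i,j) = (A *\<^sub>v f j) $ i" using A S colS by auto
    then show "(A * S) $$ (i, j) = Q $$ (i, j)" using f[OF ij(2)] ij Qc by auto
  qed (use A S Qc in auto)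
  then show ?thesis using that S Q(1) by simp
qed

lemma rank_smult_le:
  assumes A: "(A :: 'f::field mat) \<in> carrier_mat m n"
  shows "vec_space.rank m (c \<cdot>\<^sub>m A) \<le> vec_space.rank m A"
proof -
  have "c \<cdot>\<^sub>m A = A * (c \<cdot>\<^sub>m 1\<^sub>m n)" using mult_smult_distrib[OF A one_carrier_mat, of c] right_mult_one_mat[OF A] by simp
  then show ?thesis using rank_mult_le_left[OF A, of "c \<cdot>\<^sub>m 1\<^sub>m n" n] by simp
qed

lemma inj_mat_one: "inj_mat (1\<^sub>m n :: 'f::field mat) n n"
  unfolding inj_mat_def by auto

lemma inj_mat_mult:
  assumes A: "inj_mat (A :: 'f::field mat) m n" and B: "inj_mat B n d"
  shows "inj_mat (A * B) m d"
  unfolding inj_mat_def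
proof (intro conjI ballI impI)
  note c = inj_mat_carrier[OF A] inj_mat_carrier[OF B]
  show "A * B \<in> carrier_mat m d" using c by simp
  fix v assume v: "v \<in> carrier_vec d" "A * B *\<^sub>v v = 0\<^sub>v m"
  then have "A *\<^sub>v (B *\<^sub>v v) = 0\<^sub>v m" using c by (simp add: assoc_mult_mat_vec)
  then have "B *\<^sub>v v = 0\<^sub>v n" using inj_matD[OF A] c v by auto
  then show "v = 0\<^sub>v d" using inj_matD[OF B] v by auto
qed

text \<open>The common kernel of finitely many matrices has codimension at most the sum of their
  ranks. Each induction step restricts \<open>Q\<close> to the kernel of \<open>D i * Q\<close>,
  which costs the rank of \<open>D i * Q\<close> and hence at most that of
  \<open>D i\<close>.\<close>

lemma inj_mat_annihilating:
  fixes D :: "'i \<Rightarrow> 'f::field mat"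
  assumes "finite I" "\<And>i. i \<in> I \<Longrightarrow> D i \<in> carrier_mat m m"
  shows "\<exists>Q d. inj_mat Q m d \<and> (\<forall>i\<in>I. D i * Q = 0\<^sub>m m d) \<and>
     m \<le> d + (\<Sum>i\<in>I. vec_space.rank m (D i))"
  using assms
proof (induction I)
  case empty
  show ?case using inj_mat_one[of m] by fastforce
next
  case (insert i I)
  then obtain Q d where Q: "inj_mat Q m d" "\<forall>i\<in>I. D i * Q = 0\<^sub>m m d"
     "m \<le> d + (\<Sum>i\<in>I. vec_space.rank m (D i))" by auto
  note Qc = inj_mat_carrier[OF Q(1)]
  have Di: "D i \<in> carrier_mat m m" using insert by simp
  obtain K e where K: "inj_mat K d e" "D i * Q * K = 0\<^sub>m m e" "vec_space.rank m (D i * Q) + e = d"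
    using obtain_kernel_mat[of "D i * Q" m d] Di Qc by auto
  note Kc = inj_mat_carrier[OF K(1)]
  have "D j * (Q * K) = 0\<^sub>m m e" if "j \<in> insert i I" for j
  proof -
    have "D j * (Q * K) = D j * Q * K" using assoc_mult_mat[OF insert.prems(1)[OF that] Qc Kc] by simp
    then show ?thesis using that K(2) Q(2) Kc by auto
  qed
  moreover have "m \<le> e + (\<Sum>i\<in>insert i I. vec_space.rank m (D i))"
    using Q(3) K(3) rank_mult_le_left[OF Di Qc] insert.hyps by simp
  ultimately show ?case using inj_mat_mult[OF Q(1) K(1)] by blast
qed

section \<open>Block diagonal matrices\<close>

definition block_sum :: "'f::field mat \<Rightarrow> 'f mat \<Rightarrow> 'f mat" where
  "block_sum A B = four_block_mat A (0\<^sub>m (dim_row A) (dim_col B)) (0\<^sub>m (dim_row B) (dim_col A)) B"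

lemma block_sum_carrier:
  "A \<in> carrier_mat m1 n1 \<Longrightarrow> B \<in> carrier_mat m2 n2 \<Longrightarrow> block_sum A B \<in> carrier_mat (m1 + m2) (n1 + n2)"
  unfolding block_sum_def by simp

lemma block_sum_mult:
  assumes "(A :: 'f::field mat) \<in> carrier_mat m1 n1" "B \<in> carrier_mat m2 n2"
    "C \<in> carrier_mat n1 d1" "D \<in> carrier_mat n2 d2"
  shows "block_sum A B * block_sum C D = block_sum (A * C) (B * D)"
  using assms unfolding block_sum_def
  by (subst mult_four_block_mat[of _ m1 n1 _ n2 _ m2 _ _ d1 _ d2]) auto

lemma block_sum_add:
  assumes "(A :: 'f::field mat) \<in> carrier_mat m1 n1" "B \<in> carrier_mat m2 n2"
    "C \<in> carrier_mat m1 n1" "D \<in> carrier_mat m2 n2"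
  shows "block_sum A B + block_sum C D = block_sum (A + C) (B + D)"
  using assms unfolding block_sum_def by (intro eq_matI) auto

lemma block_sum_smult: "c \<cdot>\<^sub>m block_sum A B = block_sum (c \<cdot>\<^sub>m A) (c \<cdot>\<^sub>m B)"
  unfolding block_sum_def by (intro eq_matI) auto

lemma block_sum_one: "block_sum (1\<^sub>m m) (1\<^sub>m n) = (1\<^sub>m (m + n) :: 'f::field mat)"
  unfolding block_sum_def by simp

text \<open>A vector splits into two halves on which the blocks act separately. The blocks may be
  rectangular, since this is applied to bases of subspaces.\<close>

lemma inj_mat_block_sum:
  assumes A: "inj_mat (A :: 'f::field mat) m1 d1" and B: "inj_mat B m2 d2"
  shows "inj_mat (block_sum A B) (m1 + m2) (d1 + d2)"
  unfolding inj_mat_def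
proof (intro conjI ballI impI)
  note c = inj_mat_carrier[OF A] inj_mat_carrier[OF B]
  show "block_sum A B \<in> carrier_mat (m1 + m2) (d1 + d2)" using c by (rule block_sum_carrier)
  fix v assume v: "v \<in> carrier_vec (d1 + d2)" and 0: "block_sum A B *\<^sub>v v = 0\<^sub>v (m1 + m2)"
  define x y where "x = vec_first v d1" and "y = vec_last v d2"
  have xy: "x \<in> carrier_vec d1" "y \<in> carrier_vec d2" "v = x @\<^sub>v y"
    using vec_first_last_append[OF v] by (auto simp: x_def y_def)
  have "block_sum A B *\<^sub>v v = (A *\<^sub>v x + 0\<^sub>m m1 d2 *\<^sub>v y) @\<^sub>v (0\<^sub>m m2 d1 *\<^sub>v x + B *\<^sub>v y)"
    unfolding block_sum_def xy(3) using c xy(1,2)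
    by (subst four_block_mat_mult_vec[of A m1 d1 _ d2 _ m2]) auto
  moreover have "A *\<^sub>v x + 0\<^sub>m m1 d2 *\<^sub>v y = A *\<^sub>v x" "0\<^sub>m m2 d1 *\<^sub>v x + B *\<^sub>v y = B *\<^sub>v y"
    using c xy(1,2) by auto
  moreover have "0\<^sub>v (m1 + m2) = (0\<^sub>v m1 @\<^sub>v 0\<^sub>v m2 :: 'f vec)" by (rule eq_vecI) auto
  ultimately have e: "(A *\<^sub>v x) @\<^sub>v (B *\<^sub>v y) = 0\<^sub>v m1 @\<^sub>v 0\<^sub>v m2"
    using 0 by simp
  have "A *\<^sub>v x = 0\<^sub>v m1 \<and> B *\<^sub>v y = 0\<^sub>v m2"
    using append_vec_eq[of "A *\<^sub>v x" m1 "0\<^sub>v m1" "B *\<^sub>v y" "0\<^sub>v m2"] e c xy by auto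
  then have "x = 0\<^sub>v d1" "y = 0\<^sub>v d2" using inj_matD[OF A] inj_matD[OF B] xy by auto
  then show "v = 0\<^sub>v (d1 + d2)" using xy by (auto intro!: eq_vecI)
qed

text \<open>The block sum of rank sections of \<open>A\<close> and \<open>B\<close> is a rank
  certificate for the block sum. The lower bound keeps elements that are visible in one summand
  visible in the sum.\<close>

lemma rank_block_sum_ge:
  assumes A: "(A :: 'f::field mat) \<in> carrier_mat m1 n1" and B: "B \<in> carrier_mat m2 n2"
  shows "vec_space.rank m1 A + vec_space.rank m2 B \<le> vec_space.rank (m1 + m2) (block_sum A B)"
proof -
  obtain S where S: "S \<in> carrier_mat n1 (vec_space.rank m1 A)" "inj_mat (A * S) m1 (vec_space.rank m1 A)"
    by (rule obtain_rank_section[OF A])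
  obtain T where T: "T \<in> carrier_mat n2 (vec_space.rank m2 B)" "inj_mat (B * T) m2 (vec_space.rank m2 B)"
    by (rule obtain_rank_section[OF B])
  show ?thesis
    using rank_ge_inj_mult[OF block_sum_carrier[OF A B] block_sum_carrier[OF S(1) T(1)]]
      inj_mat_block_sum[OF S(2) T(2)] block_sum_mult[OF A B S(1) T(1)] by simp
qed

section \<open>Almost representations and their direct sums\<close>

text \<open>The subspace \<open>W\<close> of the definition is the column space of \<open>Q\<close>,
  whose dimension is \<open>d\<close> because \<open>Q\<close> is injective.\<close>

lemma almost_repI:
  fixes \<psi> :: "'a::ring_1 \<Rightarrow> 'f::field mat"
  assumes "\<And>a. a \<in> L \<Longrightarrow> \<psi> a \<in> carrier_mat m m"
    "\<And>a b. a \<in> L \<Longrightarrow> b \<in> L \<Longrightarrow> \<psi> (a + b) = \<psi> a + \<psi> b"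
    "\<And>c a. a \<in> L \<Longrightarrow> \<psi> (scale c a) = c \<cdot>\<^sub>m \<psi> a"
    "\<psi> 1 = 1\<^sub>m m"
    and Q: "inj_mat Q m d" and "real m - real d < \<epsilon> * real m"
    and mult: "\<And>a b. a \<in> L \<Longrightarrow> b \<in> L \<Longrightarrow> a * b \<in> L \<Longrightarrow> \<psi> a * \<psi> b * Q = \<psi> (a * b) * Q"
  shows "almost_rep scale L \<epsilon> m \<psi>"
  unfolding almost_rep_def
proof (intro conjI)
  note Qc = inj_mat_carrier[OF Q]
  let ?W = "(\<lambda>v. Q *\<^sub>v v) ` carrier_vec d"
  show "\<exists>W. subspace (class_ring :: 'f ring) W (module_vec TYPE('f) m) \<and>
        real m - real (vectorspace.dim (class_ring :: 'f ring) ((module_vec TYPE('f) m)\<lparr>carrier := W\<rparr>))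
          < \<epsilon> * real m \<and>
        (\<forall>a\<in>L. \<forall>b\<in>L. a * b \<in> L \<longrightarrow>
           (\<forall>v\<in>W. \<psi> a *\<^sub>v (\<psi> b *\<^sub>v v) = \<psi> (a * b) *\<^sub>v v))"
  proof (intro exI[of _ ?W] conjI)
    show "subspace (class_ring :: 'f ring) ?W (module_vec TYPE('f) m)" by (rule subspace_image_mat[OF Qc])
    show "real m - real (vectorspace.dim (class_ring :: 'f ring) ((module_vec TYPE('f) m)\<lparr>carrier := ?W\<rparr>))
          < \<epsilon> * real m"
      using rank_eq_dim_image[OF Qc] rank_inj_mat[OF Q] assms(6) by simp
    show "\<forall>a\<in>L. \<forall>b\<in>L. a * b \<in> L \<longrightarrow>
           (\<forall>v\<in>?W. \<psi> a *\<^sub>v (\<psi> b *\<^sub>v v) = \<psi> (a * b) *\<^sub>v v)"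
    proof (intro ballI impI)
      fix a b v assume ab: "a \<in> L" "b \<in> L" "a * b \<in> L" and "v \<in> ?W"
      then obtain x where x: "x \<in> carrier_vec d" "v = Q *\<^sub>v x" by blast
      have c: "\<psi> a \<in> carrier_mat m m" "\<psi> b \<in> carrier_mat m m" "\<psi> (a * b) \<in> carrier_mat m m"
        using ab assms(1) by auto
      have "\<psi> a *\<^sub>v (\<psi> b *\<^sub>v v) = (\<psi> a * \<psi> b * Q) *\<^sub>v x"
        unfolding x(2) using c Qc x(1) by (simp add: assoc_mult_mat_vec[of _ m m] assoc_mult_mat_vec[of _ m m _ d])
      also have "\<dots> = \<psi> (a * b) *\<^sub>v v"
        unfolding mult[OF ab] x(2) using c Qc x(1) by (simp add: assoc_mult_mat_vec[of _ m m _ d])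
      finally show "\<psi> a *\<^sub>v (\<psi> b *\<^sub>v v) = \<psi> (a * b) *\<^sub>v v" .
    qed
  qed
qed (use assms in auto)

text \<open>The columns of \<open>Q\<close> form a basis of the subspace \<open>W\<close>; the
  pointwise identity on \<open>W\<close> is read off column by column.\<close>

lemma almost_repE:
  fixes \<psi> :: "'a::ring_1 \<Rightarrow> 'f::field mat"
  assumes "almost_rep scale L \<epsilon> m \<psi>"
  obtains Q d where "inj_mat Q m d" "real m - real d < \<epsilon> * real m"
    "\<And>a b. a \<in> L \<Longrightarrow> b \<in> L \<Longrightarrow> a * b \<in> L \<Longrightarrow> \<psi> a * \<psi> b * Q = \<psi> (a * b) * Q"
proof -
  have c: "\<And>a. a \<in> L \<Longrightarrow> \<psi> a \<in> carrier_mat m m" using assms by (simp add: almost_rep_def)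
  obtain W where W: "subspace (class_ring :: 'f ring) W (module_vec TYPE('f) m)"
    "real m - real (vectorspace.dim (class_ring :: 'f ring) ((module_vec TYPE('f) m)\<lparr>carrier := W\<rparr>))
          < \<epsilon> * real m"
    "\<forall>a\<in>L. \<forall>b\<in>L. a * b \<in> L \<longrightarrow> (\<forall>v\<in>W. \<psi> a *\<^sub>v (\<psi> b *\<^sub>v v) = \<psi> (a * b) *\<^sub>v v)"
    using assms unfolding almost_rep_def by blast
  obtain Q where Q: "inj_mat Q m
      (vectorspace.dim (class_ring :: 'f ring) ((module_vec TYPE('f) m)\<lparr>carrier := W\<rparr>))"
    "set (cols Q) \<subseteq> W" by (rule subspace_vec_obtain_inj_mat[OF W(1)])
  note Qc = inj_mat_carrier[OF Q(1)]
  have "\<psi> a * \<psi> b * Q = \<psi> (a * b) * Q" if ab: "a \<in> L" "b \<in> L" "a * b \<in> L" for a b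
  proof (rule eq_matI)
    fix i j assume ij: "i < dim_row (\<psi> (a * b) * Q)" "j < dim_col (\<psi> (a * b) * Q)"
    note cc = c[OF ab(1)] c[OF ab(2)] c[OF ab(3)]
    have "col Q j \<in> set (cols Q)" using ij by (auto simp: cols_def)
    then have "col Q j \<in> W" using Q by blast
    then have *: "\<psi> a *\<^sub>v (\<psi> b *\<^sub>v col Q j) = \<psi> (a * b) *\<^sub>v col Q j" using W(3) ab by blast
    have col_carrier: "col Q j \<in> carrier_vec m" 
      using col_dim[of Q j] carrier_matD(1)[OF Qc] by simp
    have e: "(\<psi> a * \<psi> b) *\<^sub>v col Q j = \<psi> (a * b) *\<^sub>v col Q j"
      using assoc_mult_mat_vec[OF cc(1,2) col_carrier] * by (rule trans)
    have "(\<psi> a * \<psi> b * Q) $$ (i, j) = ((\<psi> a * \<psi> b) *\<^sub>v col Q j) $ i"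
      using ij carrier_matD[OF cc(1)] carrier_matD[OF cc(2)] carrier_matD[OF cc(3)] by simp
    also have "\<dots> = (\<psi> (a * b) * Q) $$ (i, j)" unfolding e using ij by simp
    finally show "(\<psi> a * \<psi> b * Q) $$ (i, j) = (\<psi> (a * b) * Q) $$ (i, j)" .
  qed (use carrier_matD[OF c[OF ab(1)]] carrier_matD[OF c[OF ab(3)]] in simp_all)
  then show ?thesis by (rule that[OF Q(1) W(2)])
qed

text \<open>For \<open>m = 0\<close> the strict bound on the codimension would read
  \<open>0 < 0\<close>.\<close>

lemma almost_rep_pos_dim:
  assumes "almost_rep scale L \<epsilon> m (\<psi> :: 'a::ring_1 \<Rightarrow> 'f::field mat)"
  shows "0 < m"
proof -
  obtain Q :: "'f mat" and d where "inj_mat Q m d" "real m - real d < \<epsilon> * real m" using almost_repE[OF assms] by metis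
  then show ?thesis using inj_mat_dim_le[of Q m d] by (cases m) auto
qed

text \<open>The defect vanishes on the columns of \<open>Q\<close>, so its rank is at most the
  codimension \<open>m - d\<close>. This translates the condition on subspaces into the normalised
  rank.\<close>

lemma almost_rep_rank_defect:
  assumes r: "almost_rep scale L \<epsilon> m (\<psi> :: 'a::ring_1 \<Rightarrow> 'f::field mat)" and ab: "a \<in> L" "b \<in> L" "a * b \<in> L"
  shows "real (vec_space.rank m (\<psi> (a * b) - \<psi> a * \<psi> b)) < \<epsilon> * real m"
proof -
  have c: "\<psi> a \<in> carrier_mat m m" "\<psi> b \<in> carrier_mat m m" "\<psi> (a * b) \<in> carrier_mat m m"
    using assms by (auto simp: almost_rep_def)
  obtain Q d where Q: "inj_mat Q m d" "real m - real d < \<epsilon> * real m"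
    "\<psi> a * \<psi> b * Q = \<psi> (a * b) * Q" using r ab by (elim almost_repE) blast
  note Qc = inj_mat_carrier[OF Q(1)]
  have "(\<psi> (a * b) - \<psi> a * \<psi> b) * Q = \<psi> (a * b) * Q - \<psi> a * \<psi> b * Q"
    using c Qc by (intro minus_mult_distrib_mat) auto
  also have "\<dots> = 0\<^sub>m m d" unfolding Q(3) using c Qc by auto
  finally have "vec_space.rank m (\<psi> (a * b) - \<psi> a * \<psi> b) + d \<le> m"
    using c by (intro rank_add_le_of_mult_inj_zero[OF _ Q(1)]) auto
  then show ?thesis using Q(2) by linarith
qed

text \<open>The good subspaces are added as well. Their codimensions are below \<epsilon> times
  \<open>m1\<close> and \<epsilon> times \<open>m2\<close>, so \<epsilon> does not
  deteriorate.\<close>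

lemma almost_rep_block_sum:
  assumes r1: "almost_rep scale L \<epsilon> m1 (\<psi>1 :: 'a::ring_1 \<Rightarrow> 'f::field mat)"
    and r2: "almost_rep scale L \<epsilon> m2 \<psi>2"
  shows "almost_rep scale L \<epsilon> (m1 + m2) (\<lambda>a. block_sum (\<psi>1 a) (\<psi>2 a))"
proof -
  have c: "\<psi>1 a \<in> carrier_mat m1 m1" "\<psi>2 a \<in> carrier_mat m2 m2" if "a \<in> L" for a
    using that r1 r2 by (auto simp: almost_rep_def)
  obtain Q1 d1 where Q1: "inj_mat Q1 m1 d1" "real m1 - real d1 < \<epsilon> * real m1"
    "\<And>a b. a \<in> L \<Longrightarrow> b \<in> L \<Longrightarrow> a * b \<in> L \<Longrightarrow> \<psi>1 a * \<psi>1 b * Q1 = \<psi>1 (a * b) * Q1"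
    using r1 by (elim almost_repE) blast
  obtain Q2 d2 where Q2: "inj_mat Q2 m2 d2" "real m2 - real d2 < \<epsilon> * real m2"
    "\<And>a b. a \<in> L \<Longrightarrow> b \<in> L \<Longrightarrow> a * b \<in> L \<Longrightarrow> \<psi>2 a * \<psi>2 b * Q2 = \<psi>2 (a * b) * Q2"
    using r2 by (elim almost_repE) blast
  note Qc = inj_mat_carrier[OF Q1(1)] inj_mat_carrier[OF Q2(1)]
  show ?thesis
  proof (rule almost_repI[OF _ _ _ _ inj_mat_block_sum[OF Q1(1) Q2(1)]])
    show "real (m1 + m2) - real (d1 + d2) < \<epsilon> * real (m1 + m2)"
      using Q1(2) Q2(2) by (simp add: distrib_left)
    show "block_sum (\<psi>1 a) (\<psi>2 a) * block_sum (\<psi>1 b) (\<psi>2 b) * block_sum Q1 Q2 = block_sum (\<psi>1 (a * b)) (\<psi>2 (a * b)) * block_sum Q1 Q2"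
      if "a \<in> L" "b \<in> L" "a * b \<in> L" for a b
      using c[OF that(1)] c[OF that(2)] c[OF that(3)] Qc Q1(3)[OF that] Q2(3)[OF that]
      by (simp add: block_sum_mult[of _ m1 m1 _ m2 m2 _ m1 _ m2] block_sum_mult[of _ m1 m1 _ m2 m2 _ d1 _ d2])
    show "block_sum (\<psi>1 1) (\<psi>2 1) = 1\<^sub>m (m1 + m2)" using r1 r2 by (simp add: almost_rep_def block_sum_one)
    show "block_sum (\<psi>1 (scale k a)) (\<psi>2 (scale k a)) = k \<cdot>\<^sub>m block_sum (\<psi>1 a) (\<psi>2 a)" if "a \<in> L" for k a
      using that r1 r2 by (simp add: almost_rep_def block_sum_smult)
    show "block_sum (\<psi>1 (a + b)) (\<psi>2 (a + b)) = block_sum (\<psi>1 a) (\<psi>2 a) + block_sum (\<psi>1 b) (\<psi>2 b)"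
      if "a \<in> L" "b \<in> L" for a b
      using that r1 r2 c[OF that(1)] c[OF that(2)]
      by (simp add: almost_rep_def block_sum_add[of _ m1 m1 _ m2 m2])
    show "block_sum (\<psi>1 a) (\<psi>2 a) \<in> carrier_mat (m1 + m2) (m1 + m2)" if "a \<in> L" for a
      using block_sum_carrier c that by blast
  qed
qed

text \<open>Repetition enlarges the space without lowering any rank ratio. The count is
  \<open>Suc k\<close> because an almost representation has positive dimension.\<close>

lemma almost_rep_copies:
  assumes r: "almost_rep scale L \<epsilon> m (\<psi> :: 'a::ring_1 \<Rightarrow> 'f::field mat)"
  shows "\<exists>\<psi>'. almost_rep scale L \<epsilon> (Suc k * m) \<psi>' \<and>
     (\<forall>a\<in>L. Suc k * vec_space.rank m (\<psi> a) \<le> vec_space.rank (Suc k * m) (\<psi>' a))"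
proof (induction k)
  case 0
  then show ?case using r by auto
next
  case (Suc k)
  then obtain \<psi>' where p: "almost_rep scale L \<epsilon> (Suc k * m) \<psi>'"
     "\<forall>a\<in>L. Suc k * vec_space.rank m (\<psi> a) \<le> vec_space.rank (Suc k * m) (\<psi>' a)" by blast
  have e: "Suc (Suc k) * m = m + Suc k * m" by simp
  show ?case unfolding e
  proof (intro exI conjI ballI)
    show "almost_rep scale L \<epsilon> (m + Suc k * m) (\<lambda>a. block_sum (\<psi> a) (\<psi>' a))"
      by (rule almost_rep_block_sum[OF r p(1)])
    fix a assume a: "a \<in> L"
    then have "\<psi> a \<in> carrier_mat m m" "\<psi>' a \<in> carrier_mat (Suc k * m) (Suc k * m)"
      using r p(1) by (auto simp: almost_rep_def)
    then show "Suc (Suc k) * vec_space.rank m (\<psi> a) \<le> vec_space.rank (m + Suc k * m) (block_sum (\<psi> a) (\<psi>' a))"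
      using rank_block_sum_ge[of "\<psi> a" m m "\<psi>' a" "Suc k * m" "Suc k * m"] p(2) a by fastforce
  qed
qed

text \<open>\<open>m2\<close> copies of the first and \<open>m1\<close> copies of the second representation have equal weight.\<close>
lemma almost_rep_average:
  assumes r1: "almost_rep scale L \<epsilon> m1 (\<psi>1 :: 'a::ring_1 \<Rightarrow> 'f::field mat)"
    and r2: "almost_rep scale L \<epsilon> m2 \<psi>2"
  shows "\<exists>m \<psi>. almost_rep scale L \<epsilon> m \<psi> \<and>
     (\<forall>a\<in>L. real (vec_space.rank m1 (\<psi>1 a)) / real m1 + real (vec_space.rank m2 (\<psi>2 a)) / real m2
        \<le> 2 * (real (vec_space.rank m (\<psi> a)) / real m))"
proof -
  note pos = almost_rep_pos_dim[OF r1] almost_rep_pos_dim[OF r2]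
  \<comment> \<open>Both multiples have dimension \<open>m1 * m2\<close>. The index is one less than
    the number of copies, which is positive.\<close>
  obtain \<chi>1 where 1: "almost_rep scale L \<epsilon> (m2 * m1) \<chi>1"
     "\<And>a. a\<in>L \<Longrightarrow> m2 * vec_space.rank m1 (\<psi>1 a) \<le> vec_space.rank (m2 * m1) (\<chi>1 a)"
    using almost_rep_copies[OF r1, of "m2 - 1"] pos by auto
  obtain \<chi>2 where 2: "almost_rep scale L \<epsilon> (m1 * m2) \<chi>2"
     "\<And>a. a\<in>L \<Longrightarrow> m1 * vec_space.rank m2 (\<psi>2 a) \<le> vec_space.rank (m1 * m2) (\<chi>2 a)"
    using almost_rep_copies[OF r2, of "m1 - 1"] pos by auto
  show ?thesis
  proof (intro exI conjI ballI)
    show "almost_rep scale L \<epsilon> (m2 * m1 + m1 * m2) (\<lambda>a. block_sum (\<chi>1 a) (\<chi>2 a))"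
      by (rule almost_rep_block_sum[OF 1(1) 2(1)])
    fix a assume a: "a \<in> L"
    let ?r1 = "vec_space.rank m1 (\<psi>1 a)" and ?r2 = "vec_space.rank m2 (\<psi>2 a)"
    let ?r = "vec_space.rank (m2 * m1 + m1 * m2) (block_sum (\<chi>1 a) (\<chi>2 a))"
    have "\<chi>1 a \<in> carrier_mat (m2 * m1) (m2 * m1)" "\<chi>2 a \<in> carrier_mat (m1 * m2) (m1 * m2)"
      using a 1 2 by (auto simp: almost_rep_def)
    from rank_block_sum_ge[OF this] have "m2 * ?r1 + m1 * ?r2 \<le> ?r" using 1(2)[OF a] 2(2)[OF a] by linarith
    then have "real m2 * real ?r1 + real m1 * real ?r2 \<le> real ?r"
      unfolding of_nat_mult[symmetric] of_nat_add[symmetric] of_nat_le_iff .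
    then have "(real m2 * real ?r1 + real m1 * real ?r2) / (real m1 * real m2) \<le> real ?r / (real m1 * real m2)"
      using pos by (intro divide_right_mono) auto
    then show "real ?r1 / real m1 + real ?r2 / real m2 \<le> 2 * (real ?r / real (m2 * m1 + m1 * m2))"
      using pos by (simp add: add_divide_distrib mult.commute[of "real m2"])
  qed
qed

text \<open>Averaging the first representation with a weighted sum of the others halves all weights
  of the latter, so index \<open>i\<close> keeps at least the weight \<open>1 / 2 ^ Suc i\<close>.
  This weight does not depend on \<open>k\<close>, which matters when \<open>k\<close> tends to
  infinity.\<close>

lemma almost_rep_weighted_sum:
  fixes \<psi> :: "nat \<Rightarrow> 'a::ring_1 \<Rightarrow> 'f::field mat"
  assumes "\<And>i. i \<le> k \<Longrightarrow> almost_rep scale L \<epsilon> (m i) (\<psi> i)"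
  shows "\<exists>M \<chi>. almost_rep scale L \<epsilon> M \<chi> \<and>
     (\<forall>i\<le>k. \<forall>a\<in>L. real (vec_space.rank (m i) (\<psi> i a)) / real (m i)
        \<le> 2 ^ Suc i * (real (vec_space.rank M (\<chi> a)) / real M))"
  using assms
proof (induction k arbitrary: m \<psi>)
  case 0
  \<comment> \<open>A single representation has full weight, so the factor 2 is satisfied with room
    to spare.\<close>
  then show ?case by (intro exI[of _ "m 0"] exI[of _ "\<psi> 0"]) (auto intro!: divide_right_mono)
next
  case (Suc k)
  \<comment> \<open>The induction hypothesis is applied to the tail, with all indices shifted by
    one.\<close>
  obtain M \<chi> where M: "almost_rep scale L \<epsilon> M \<chi>"
     "\<And>i a. i \<le> k \<Longrightarrow> a\<in>L \<Longrightarrow> real (vec_space.rank (m (Suc i)) (\<psi> (Suc i) a)) / real (m (Suc i))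
        \<le> 2 ^ Suc i * (real (vec_space.rank M (\<chi> a)) / real M)"
    using Suc.IH[of "\<lambda>i. m (Suc i)" "\<lambda>i. \<psi> (Suc i)"] Suc.prems by auto
  obtain N \<theta> where N: "almost_rep scale L \<epsilon> N \<theta>"
     "\<And>a. a\<in>L \<Longrightarrow> real (vec_space.rank (m 0) (\<psi> 0 a)) / real (m 0) + real (vec_space.rank M (\<chi> a)) / real M
        \<le> 2 * (real (vec_space.rank N (\<theta> a)) / real N)"
    using almost_rep_average[OF Suc.prems[of 0] M(1)] by auto
  have "real (vec_space.rank (m i) (\<psi> i a)) / real (m i)
        \<le> 2 ^ Suc i * (real (vec_space.rank N (\<theta> a)) / real N)" if "i \<le> Suc k" "a \<in> L" for i a
  proof (cases i)
    case 0
    have "0 \<le> real (vec_space.rank M (\<chi> a)) / real M" by simp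
    then show ?thesis using N(2)[OF that(2)] unfolding 0 power_Suc power_0 by linarith
  next
    case (Suc j)
    have "0 \<le> real (vec_space.rank (m 0) (\<psi> 0 a)) / real (m 0)" by simp
    then have "real (vec_space.rank M (\<chi> a)) / real M \<le> 2 * (real (vec_space.rank N (\<theta> a)) / real N)"
      using N(2)[OF that(2)] by linarith
    then have "2 ^ Suc j * (real (vec_space.rank M (\<chi> a)) / real M)
       \<le> 2 ^ Suc j * (2 * (real (vec_space.rank N (\<theta> a)) / real N))"
      by (intro mult_left_mono) auto
    moreover have "real (vec_space.rank (m i) (\<psi> i a)) / real (m i)
        \<le> 2 ^ Suc j * (real (vec_space.rank M (\<chi> a)) / real M)"
      using M(2)[of j a] that Suc by auto
    ultimately show ?thesis unfolding Suc by (simp add: mult.assoc)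
  qed
  then show ?case using N(1) by blast
qed

section \<open>Ultrafilters and the kernel of the rank function\<close>

text \<open>Zorn's lemma for proper filters finer than \<open>sequentially\<close>. A finest one is
  an ultrafilter, and it avoids every point because \<open>sequentially\<close> does.\<close>

lemma nonprincipal_ultrafilter_exists: "\<exists>\<omega>. nonprincipal_ultrafilter \<omega>"
proof -
  define A where "A = {F :: nat filter. F \<noteq> bot \<and> F \<le> sequentially}"
  \<comment> \<open>Finer filters are smaller, so the order is reversed: a maximal element for
    \<open>P\<close> is a minimal filter.\<close>
  define P where "P F G \<longleftrightarrow> G \<le> F" for F G :: "nat filter"
  have chain_inf: "\<exists>u\<in>A. \<forall>a\<in>C. P a u" if C: "C \<in> Chains (relation_of P A)" for C
  proof (cases "C = {}")
    case True
    then show ?thesis unfolding A_def using sequentially_bot by blast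
  next
    case False
    have CA: "C \<subseteq> A" and tot: "\<And>F G. F \<in> C \<Longrightarrow> G \<in> C \<Longrightarrow> F \<le> G \<or> G \<le> F"
      using C unfolding Chains_def relation_of_def P_def by auto
    \<comment> \<open>Finite subsets of a chain contain their infimum, so finite infima are proper;
      this suffices for the infimum of the whole chain to be proper.\<close>
    have fin: "Inf X \<in> X" if "finite X" "X \<noteq> {}" "X \<subseteq> C" for X
      using that
    proof (induction X rule: finite_ne_induct)
      case (insert F X)
      then have "Inf X \<in> X" by auto
      then have "Inf X \<le> F \<or> F \<le> Inf X" using insert.prems tot by auto
      then show ?case using \<open>Inf X \<in> X\<close> by (auto simp: inf_absorb1 inf_absorb2)
    qed simp
    have "Inf C \<noteq> bot"
    proof (rule Inf_filter_not_bot)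
      fix X assume X: "X \<subseteq> C" "finite X"
      show "Inf X \<noteq> bot"
      proof (cases "X = {}")
        case False
        then show ?thesis using fin[OF X(2) _ X(1)] CA X(1) unfolding A_def by blast
      qed (simp add: filter_eq_iff exI[of _ "\<lambda>_. False"])
    qed
    moreover obtain F where "F \<in> C" using False by blast
    then have "Inf C \<le> sequentially" using CA Inf_lower[of F C] unfolding A_def by (auto intro: order_trans)
    ultimately have "Inf C \<in> A" by (simp add: A_def)
    then show ?thesis unfolding P_def by (meson Inf_lower)
  qed
  have "partial_order_on A (relation_of P A)"
    by (rule partial_order_on_relation_ofI) (auto simp: P_def)
  from predicate_Zorn[OF this chain_inf] obtain U
    where U: "U \<in> A" and min: "\<And>F. F \<in> A \<Longrightarrow> F \<le> U \<Longrightarrow> F = U"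
    unfolding P_def by blast
  have "nonprincipal_ultrafilter U" unfolding nonprincipal_ultrafilter_def
  proof (intro conjI allI)
    show "U \<noteq> bot" using U by (simp add: A_def)
    show "eventually (\<lambda>x. x \<noteq> k) U" for k
    proof (rule filter_leD[of U sequentially])
      show "\<forall>\<^sub>F x in sequentially. x \<noteq> k" using eventually_gt_at_top[of k] by eventually_elim auto
    qed (use U in \<open>simp add: A_def\<close>)
    fix Q :: "nat \<Rightarrow> bool"
    show "eventually Q U \<or> eventually (\<lambda>x. \<not> Q x) U"
    proof (cases "eventually (\<lambda>x. \<not> Q x) U")
      case False
      \<comment> \<open>Adding the set of \<open>Q\<close> to \<open>U\<close> gives a proper finer
        filter, which by minimality is \<open>U\<close> itself.\<close>
      have "inf U (principal {x. Q x}) \<noteq> bot"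
        using False by (simp add: trivial_limit_def eventually_inf_principal)
      then have "inf U (principal {x. Q x}) = U"
        using U by (intro min) (auto simp: A_def intro: order_trans[OF inf_le1])
      moreover have "eventually Q (inf U (principal {x. Q x}))"
        by (simp add: eventually_inf_principal)
      ultimately show ?thesis by simp
    qed simp
  qed
  then show ?thesis by blast
qed

text \<open>Avoiding single points implies avoiding every finite initial segment. Statements valid
  for all large \<open>k\<close> thereby hold along \<omega>.\<close>

lemma nonprincipal_ultrafilter_le_sequentially:
  assumes "nonprincipal_ultrafilter \<omega>" shows "\<omega> \<le> sequentially"
proof (rule filter_leI)
  fix P assume "eventually P sequentially"
  then obtain N where N: "\<And>n. n \<ge> N \<Longrightarrow> P n" by (auto simp: eventually_sequentially)
  have "eventually (\<lambda>x. \<forall>k\<in>{..<N}. x \<noteq> k) \<omega>"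
    using assms by (intro eventually_ball_finite) (auto simp: nonprincipal_ultrafilter_def)
  then show "eventually P \<omega>"
  proof eventually_elim
    case (elim x)
    then show ?case using N[of x] by (metis lessThan_iff not_le)
  qed
qed

section \<open>The normalised rank and congruence modulo its kernel\<close>

lemma rho_eq: "A \<in> carrier_mat m m \<Longrightarrow> rho A = real (vec_space.rank m A) / real m"
  unfolding rho_def by auto

lemma rho_nonneg: "0 \<le> rho A"
  unfolding rho_def by simp

lemma rho_zero: "rho (0\<^sub>m m m :: 'f::field mat) = 0"
  using rho_eq[of "0\<^sub>m m m :: 'f mat" m] vec_space.rank_0I[of m m, where 'a = 'f] by simp

lemma rho_minus_self: "(A :: 'f::field mat) \<in> carrier_mat m m \<Longrightarrow> rho (A - A) = 0"
  by (simp add: minus_r_inv_mat rho_zero)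

lemma rho_add_le:
  assumes "(A :: 'f::field mat) \<in> carrier_mat m m" "B \<in> carrier_mat m m"
  shows "rho (A + B) \<le> rho A + rho B"
  using vec_space.rank_subadditive[OF assms] assms
  by (simp add: rho_eq[of _ m] add_divide_distrib[symmetric] divide_right_mono flip: of_nat_add)

lemma rho_smult_le:
  assumes "(A :: 'f::field mat) \<in> carrier_mat m m" shows "rho (c \<cdot>\<^sub>m A) \<le> rho A"
  using rank_smult_le[OF assms] assms by (simp add: rho_eq[of _ m] divide_right_mono)

lemma rho_mult_le:
  assumes "(A :: 'f::field mat) \<in> carrier_mat m m" "B \<in> carrier_mat m m"
  shows "rho (A * B) \<le> rho A" "rho (A * B) \<le> rho B"
  using rank_mult_le_left[OF assms] rank_mult_le_right[OF assms] assms
  by (simp_all add: rho_eq[of _ m] divide_right_mono)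

lemma in_ker_rho_le:
  assumes "in_ker_rho \<omega> y" "in_ker_rho \<omega> z" "eventually (\<lambda>k. rho (x k) \<le> rho (y k) + rho (z k)) \<omega>"
  shows "in_ker_rho \<omega> x"
  unfolding in_ker_rho_def
proof (rule tendsto_sandwich[of "\<lambda>_. 0"])
  show "((\<lambda>k. rho (y k) + rho (z k)) \<longlongrightarrow> 0) \<omega>"
    using tendsto_add[OF assms(1,2)[unfolded in_ker_rho_def]] by simp
qed (use assms(3) rho_nonneg in \<open>auto intro: tendsto_const always_eventually\<close>)

lemma in_ker_rho_mono:
  assumes "in_ker_rho \<omega> y" "eventually (\<lambda>k. rho (x k) \<le> rho (y k)) \<omega>"
  shows "in_ker_rho \<omega> x"
  using in_ker_rho_le[OF assms(1,1)] assms(2) rho_nonneg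
  by (metis (mono_tags, lifting) add_increasing eventually_mono)

lemma in_ker_rho_eventually_zero:
  assumes "eventually (\<lambda>k. rho (x k) = 0) \<omega>" shows "in_ker_rho \<omega> x"
  unfolding in_ker_rho_def using tendsto_eventually[OF assms] .

text \<open>Equality in the quotient by the kernel of the limit rank. The carriers are included so
  that matrix identities can be applied at every \<open>k\<close>.\<close>

definition cong_ker :: "nat filter \<Rightarrow> (nat \<Rightarrow> nat) \<Rightarrow> (nat \<Rightarrow> 'f::field mat) \<Rightarrow> (nat \<Rightarrow> 'f mat) \<Rightarrow> bool" where
  "cong_ker \<omega> n x y \<longleftrightarrow> (\<forall>k. x k \<in> carrier_mat (n k) (n k)) \<and> (\<forall>k. y k \<in> carrier_mat (n k) (n k)) \<and>
     in_ker_rho \<omega> (\<lambda>k. x k - y k)"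

lemma cong_ker_refl:
  assumes "\<And>k. x k \<in> carrier_mat (n k) (n k)" shows "cong_ker \<omega> n x x"
  unfolding cong_ker_def using assms
  by (auto intro!: in_ker_rho_eventually_zero always_eventually simp: minus_r_inv_mat[OF assms] rho_zero)

lemma cong_ker_sym:
  assumes "cong_ker \<omega> n x y" shows "cong_ker \<omega> n y x"
proof -
  have c: "\<And>k. x k \<in> carrier_mat (n k) (n k)" "\<And>k. y k \<in> carrier_mat (n k) (n k)"
    and "in_ker_rho \<omega> (\<lambda>k. x k - y k)" using assms by (auto simp: cong_ker_def)
  from this(3) have "in_ker_rho \<omega> (\<lambda>k. y k - x k)"
  proof (rule in_ker_rho_mono, intro always_eventually allI)
    fix k
    have "y k - x k = (-1) \<cdot>\<^sub>m (x k - y k)" using c[of k] by (intro eq_matI) auto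
    then show "rho (y k - x k) \<le> rho (x k - y k)"
      using rho_smult_le[of "x k - y k" "n k" "-1"] c[of k] by (simp add: minus_carrier_mat)
  qed
  then show ?thesis using c by (simp add: cong_ker_def)
qed

lemma cong_ker_trans:
  assumes "cong_ker \<omega> n x y" "cong_ker \<omega> n y z" shows "cong_ker \<omega> n x z"
proof -
  have c: "\<And>k. x k \<in> carrier_mat (n k) (n k)" "\<And>k. y k \<in> carrier_mat (n k) (n k)" "\<And>k. z k \<in> carrier_mat (n k) (n k)"
    and k: "in_ker_rho \<omega> (\<lambda>k. x k - y k)" "in_ker_rho \<omega> (\<lambda>k. y k - z k)"
    using assms by (auto simp: cong_ker_def)
  from k have "in_ker_rho \<omega> (\<lambda>k. x k - z k)"
  proof (rule in_ker_rho_le, intro always_eventually allI)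
    fix k
    have "x k - z k = (x k - y k) + (y k - z k)" using c[of k] by (intro eq_matI) auto
    then show "rho (x k - z k) \<le> rho (x k - y k) + rho (y k - z k)"
      using rho_add_le[of "x k - y k" "n k" "y k - z k"] c[of k] by (simp add: minus_carrier_mat)
  qed
  then show ?thesis using c by (simp add: cong_ker_def)
qed

lemma cong_ker_add:
  assumes "cong_ker \<omega> n x y" "cong_ker \<omega> n x' y'"
  shows "cong_ker \<omega> n (\<lambda>k. x k + x' k) (\<lambda>k. y k + y' k)"
proof -
  have c: "\<And>k. x k \<in> carrier_mat (n k) (n k)" "\<And>k. y k \<in> carrier_mat (n k) (n k)"
     "\<And>k. x' k \<in> carrier_mat (n k) (n k)" "\<And>k. y' k \<in> carrier_mat (n k) (n k)"
    and k: "in_ker_rho \<omega> (\<lambda>k. x k - y k)" "in_ker_rho \<omega> (\<lambda>k. x' k - y' k)"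
    using assms by (auto simp: cong_ker_def)
  from k have "in_ker_rho \<omega> (\<lambda>k. (x k + x' k) - (y k + y' k))"
  proof (rule in_ker_rho_le, intro always_eventually allI)
    fix k
    have "(x k + x' k) - (y k + y' k) = (x k - y k) + (x' k - y' k)" using c[of k] by (intro eq_matI) auto
    then show "rho ((x k + x' k) - (y k + y' k)) \<le> rho (x k - y k) + rho (x' k - y' k)"
      using rho_add_le[of "x k - y k" "n k" "x' k - y' k"] c[of k] by (simp add: minus_carrier_mat)
  qed
  then show ?thesis using c by (simp add: cong_ker_def)
qed

lemma cong_ker_smult:
  assumes "cong_ker \<omega> n x y" shows "cong_ker \<omega> n (\<lambda>k. c \<cdot>\<^sub>m x k) (\<lambda>k. c \<cdot>\<^sub>m y k)"
proof -
  have c: "\<And>k. x k \<in> carrier_mat (n k) (n k)" "\<And>k. y k \<in> carrier_mat (n k) (n k)"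
    and k: "in_ker_rho \<omega> (\<lambda>k. x k - y k)"
    using assms by (auto simp: cong_ker_def)
  from k have "in_ker_rho \<omega> (\<lambda>k. c \<cdot>\<^sub>m x k - c \<cdot>\<^sub>m y k)"
  proof (rule in_ker_rho_mono, intro always_eventually allI)
    fix k
    have "c \<cdot>\<^sub>m x k - c \<cdot>\<^sub>m y k = c \<cdot>\<^sub>m (x k - y k)"
      using c[of k] by (intro eq_matI) (auto simp: algebra_simps)
    then show "rho (c \<cdot>\<^sub>m x k - c \<cdot>\<^sub>m y k) \<le> rho (x k - y k)"
      using rho_smult_le[of "x k - y k" "n k" c] c[of k] by (simp add: minus_carrier_mat)
  qed
  then show ?thesis using c by (simp add: cong_ker_def)
qed

text \<open>The kernel is a two-sided ideal:
  \<open>x * x' - y * y' = (x - y) * x' + y * (x' - y')\<close>, and a product has rank at most that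
  of either factor.\<close>

lemma cong_ker_mult:
  assumes "cong_ker \<omega> n x y" "cong_ker \<omega> n x' y'"
  shows "cong_ker \<omega> n (\<lambda>k. x k * x' k) (\<lambda>k. y k * y' k)"
proof -
  have c: "\<And>k. x k \<in> carrier_mat (n k) (n k)" "\<And>k. y k \<in> carrier_mat (n k) (n k)"
     "\<And>k. x' k \<in> carrier_mat (n k) (n k)" "\<And>k. y' k \<in> carrier_mat (n k) (n k)"
    and k: "in_ker_rho \<omega> (\<lambda>k. x k - y k)" "in_ker_rho \<omega> (\<lambda>k. x' k - y' k)"
    using assms by (auto simp: cong_ker_def)
  from k have "in_ker_rho \<omega> (\<lambda>k. x k * x' k - y k * y' k)"
  proof (rule in_ker_rho_le, intro always_eventually allI)
    fix k
    let ?D = "x k - y k" and ?E = "x' k - y' k"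
    have d: "?D \<in> carrier_mat (n k) (n k)" "?E \<in> carrier_mat (n k) (n k)"
      using c[of k] by (auto simp: minus_carrier_mat)
    have "?D * x' k = x k * x' k - y k * x' k" "y k * ?E = y k * x' k - y k * y' k"
      using c[of k] by (auto intro: minus_mult_distrib_mat mult_minus_distrib_mat)
    then have "x k * x' k - y k * y' k = ?D * x' k + y k * ?E"
      using c[of k] by (intro eq_matI) auto
    also have "rho \<dots> \<le> rho (?D * x' k) + rho (y k * ?E)"
      using c[of k] d by (intro rho_add_le) auto
    also have "\<dots> \<le> rho ?D + rho ?E"
      using rho_mult_le(1)[OF d(1) c(3)] rho_mult_le(2)[OF c(2) d(2)] by (rule add_mono)
    finally show "rho (x k * x' k - y k * y' k) \<le> rho ?D + rho ?E" .
  qed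
  then show ?thesis
    using mult_carrier_mat[OF c(1,3)] mult_carrier_mat[OF c(2,4)] by (simp add: cong_ker_def)
qed

text \<open>A descending chain argument in a finite-dimensional space, run by induction on the
  generators. If \<open>J\<close> does not suffice after adding \<open>g\<close>, a single further
  index does: a witness \<open>x\<close> outside \<open>N i\<close> serves to eliminate the
  \<open>g\<close>-component of any other element.\<close>

lemma finite_subfamily_determines_inter:
  fixes scale :: "'f::field \<Rightarrow> 'a::ab_group_add \<Rightarrow> 'a"
  assumes vs: "vector_space scale" and "finite G"
    and N: "\<And>i. i \<in> I \<Longrightarrow> module.subspace scale (N i)"
  shows "\<exists>J. finite J \<and> J \<subseteq> I \<and> module.span scale G \<inter> \<Inter> (N ` J) \<subseteq> \<Inter> (N ` I)"
  using \<open>finite G\<close>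
proof (induction G)
  interpret vector_space scale by (rule vs)
  case empty
  have "span {} \<inter> \<Inter> (N ` {}) \<subseteq> \<Inter> (N ` I)" using N subspace_0 by auto
  then show ?case by blast
next
  interpret vector_space scale by (rule vs)
  case (insert g G)
  then obtain J where J: "finite J" "J \<subseteq> I" "span G \<inter> \<Inter> (N ` J) \<subseteq> \<Inter> (N ` I)" by blast
  show ?case
  proof (cases "span (insert g G) \<inter> \<Inter> (N ` J) \<subseteq> \<Inter> (N ` I)")
    case True
    then show ?thesis using J by blast
  next
    case False
    then obtain x i where x: "x \<in> span (insert g G)" "x \<in> \<Inter> (N ` J)" and i: "i \<in> I" "x \<notin> N i" by auto
    have sJ: "subspace (\<Inter> (N ` J))" using J N by (intro subspace_Inter) auto
    obtain c where c: "x - scale c g \<in> span G" using x(1) by (auto simp: span_insert)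
    \<comment> \<open>Otherwise \<open>x\<close> would lie in \<open>span G\<close>, and the
      induction hypothesis would put it into \<open>N i\<close>.\<close>
    have "c \<noteq> 0" using c x(2) i J(3) by auto
    have "y \<in> \<Inter> (N ` I)" if y: "y \<in> span (insert g G)" "y \<in> \<Inter> (N ` insert i J)" for y
    proof -
      obtain d where d: "y - scale d g \<in> span G" using y(1) by (auto simp: span_insert)
      \<comment> \<open>The multiple of \<open>x\<close> is chosen to cancel the
        \<open>g\<close>-component of \<open>y\<close>, so that the induction hypothesis applies to
        \<open>z\<close>.\<close>
      define z where "z = y - scale (d / c) x"
      have "z = (y - scale d g) - scale (d / c) (x - scale c g)"
        unfolding z_def using \<open>c \<noteq> 0\<close> by (simp add: scale_right_diff_distrib)
      then have "z \<in> span G" using c d by (simp add: span_diff span_scale)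
      moreover have "z \<in> \<Inter> (N ` J)"
        unfolding z_def using subspace_diff[OF sJ _ subspace_scale[OF sJ x(2)]] y(2) by auto
      ultimately have z: "z \<in> \<Inter> (N ` I)" using J(3) by blast
      have Ni: "subspace (N i)" by (rule N[OF i(1)])
      have "scale (d / c) x = y - z" by (simp add: z_def)
      then have dx: "scale (d / c) x \<in> N i" using subspace_diff[OF Ni] y(2) z i(1) by auto
      \<comment> \<open>A nonzero multiple of \<open>x\<close> in \<open>N i\<close> would put
        \<open>x\<close> into \<open>N i\<close>; hence nothing was subtracted and
        \<open>y = z\<close>.\<close>
      have "d / c = 0"
      proof (rule ccontr)
        assume "d / c \<noteq> 0"
        then have "x = scale (inverse (d / c)) (scale (d / c) x)" by simp
        then show False using subspace_scale[OF Ni dx, of "inverse (d / c)"] i(2) by simp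
      qed
      then have "z = y" unfolding z_def by simp
      then show ?thesis using z by simp
    qed
    then have "span (insert g G) \<inter> \<Inter> (N ` insert i J) \<subseteq> \<Inter> (N ` I)" by blast
    then show ?thesis using J(1,2) i(1) by (intro exI[of _ "insert i J"]) auto
  qed
qed

section \<open>From linear soficity to a trivial sofic radical\<close>

lemma zero_smult_carrier_mat:
  assumes "(A :: 'f::field mat) \<in> carrier_mat m n" shows "0 \<cdot>\<^sub>m A = 0\<^sub>m m n"
  using assms by (intro eq_matI) auto

lemma eq_of_minus_mat_eq_zero:
  assumes "(A :: 'f::field mat) \<in> carrier_mat m n" "B \<in> carrier_mat m n" "A - B = 0\<^sub>m m n"
  shows "A = B"
proof (rule eq_matI)
  fix i j assume "i < dim_row B" "j < dim_col B"
  then have ij: "i < m" "j < n" using assms(2) by auto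
  then have "(A - B) $$ (i, j) = 0" using assms(3) by simp
  then show "A $$ (i, j) = B $$ (i, j)" using ij assms(1,2) by simp
qed (use assms in auto)

lemma almost_rep_zero:
  fixes \<psi> :: "'a::ring_1 \<Rightarrow> 'f::field mat"
  assumes "vector_space scale" "almost_rep scale L \<epsilon> m \<psi>" "0 \<in> L" shows "\<psi> 0 = 0\<^sub>m m m"
proof -
  interpret vector_space scale by (rule assms(1))
  have "\<psi> (scale 0 0) = 0 \<cdot>\<^sub>m \<psi> 0" "\<psi> 0 \<in> carrier_mat m m"
    using assms(2,3) unfolding almost_rep_def by blast+
  then show ?thesis using zero_smult_carrier_mat[of "\<psi> 0"] by (simp only: scale_zero_right)
qed

text \<open>An almost representation sends 0 to a zero matrix of positive size, so the span of 1
  serves for every \<delta>.\<close>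

lemma zero_in_sofic_radical:
  fixes scale :: "'f::field \<Rightarrow> 'a::ring_1 \<Rightarrow> 'a"
  assumes "f_algebra scale" shows "0 \<in> sofic_radical scale"
proof -
  have vs: "vector_space scale" using assms by (simp add: f_algebra_def)
  interpret vector_space scale by (rule vs)
  have L: "fin_dim_subspace scale (span {1})" "1 \<in> span {1}" "0 \<in> span {1}"
    unfolding fin_dim_subspace_def by (auto simp: span_base span_zero)
  have "real (vec_space.rank m (\<psi> 0 :: 'f mat)) < \<delta> * real m"
    if "\<delta> > 0" "almost_rep scale (span {1}) \<epsilon> m \<psi>" for \<delta> \<epsilon> m \<psi>
    using almost_rep_zero[OF vs that(2) L(3)] almost_rep_pos_dim[OF that(2)] that(1)
      vec_space.rank_0I[of m m, where 'a = 'f] by simp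
  then have "\<forall>\<delta>>0. \<exists>L \<eta>. fin_dim_subspace scale L \<and> 1 \<in> L \<and> 0 \<in> L \<and> \<eta> > 0 \<and>
               (\<forall>\<epsilon> m \<psi>. 0 < \<epsilon> \<and> \<epsilon> < \<eta> \<and> almost_rep scale L \<epsilon> m \<psi> \<longrightarrow>
                  real (vec_space.rank m (\<psi> 0 :: 'f mat)) < \<delta> * real m)"
    using L by (meson zero_less_one)
  then show ?thesis unfolding sofic_radical_def by simp
qed

text \<open>A unital algebra morphism into the quotient, given by a lift. The aim is that its kernel
  contains the sofic radical; injectivity enters afterwards.\<close>

locale sofic_approximation = vector_space scale
  for scale :: "'f::field \<Rightarrow> 'a::ring_1 \<Rightarrow> 'a" +
  fixes \<omega> :: "nat filter" and n :: "nat \<Rightarrow> nat" and \<phi> :: "'a \<Rightarrow> nat \<Rightarrow> 'f mat"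
  assumes algebra: "f_algebra scale"
    and ne_bot: "\<omega> \<noteq> bot" and pos: "eventually (\<lambda>k. 0 < n k) \<omega>"
    and carrier: "\<And>a k. \<phi> a k \<in> carrier_mat (n k) (n k)"
    and one: "cong_ker \<omega> n (\<phi> 1) (\<lambda>k. 1\<^sub>m (n k))"
    and add: "\<And>a b. cong_ker \<omega> n (\<phi> (a + b)) (\<lambda>k. \<phi> a k + \<phi> b k)"
    and smult: "\<And>c a. cong_ker \<omega> n (\<phi> (scale c a)) (\<lambda>k. c \<cdot>\<^sub>m \<phi> a k)"
    and mult: "\<And>a b. cong_ker \<omega> n (\<phi> (a * b)) (\<lambda>k. \<phi> a k * \<phi> b k)"
begin

lemma scale_mult: "scale c (x * y) = scale c x * y" "scale c (x * y) = x * scale c y"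
  using algebra unfolding f_algebra_def by blast+

text \<open>The maps \<open>\<phi>\<close> only become linear in the limit. They are corrected by prescribing them on a
  basis of a space that contains all products of the generators, with 1 as a basis vector.\<close>
lemma almost_reps_of_span:
  assumes B: "finite B" "1 \<in> span B" and \<epsilon>: "\<epsilon> > 0"
  obtains \<psi> where "\<And>a. a \<in> span B \<Longrightarrow> cong_ker \<omega> n (\<psi> a) (\<phi> a)"
    "eventually (\<lambda>k. almost_rep scale (span B) \<epsilon> (n k) (\<lambda>a. \<psi> a k)) \<omega>"
proof -
  define G where "G = insert 1 (B \<union> (\<lambda>(x, y). x * y) ` (B \<times> B))"
  have "finite G" unfolding G_def using B by auto
  obtain C where C: "{1} \<subseteq> C" "C \<subseteq> G" "independent C" "G \<subseteq> span C"
    using maximal_independent_subset_extend[of "{1}" G] by (auto simp: G_def)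
  have finC: "finite C" using C(2) \<open>finite G\<close> finite_subset by blast
  have BC: "span B \<subseteq> span C" using C(4) by (intro span_minimal) (auto simp: G_def)
  have prodC: "x * y \<in> span C" if "x \<in> B" "y \<in> B" for x y using that C(4) by (auto simp: G_def)
  \<comment> \<open>An almost representation must send 1 to the identity exactly. The value at 1 is
    replaced, which changes it only by an element of the kernel.\<close>
  define \<phi>' where "\<phi>' c k = (if c = 1 then 1\<^sub>m (n k) else \<phi> c k)" for c k
  have \<phi>'c: "\<phi>' c k \<in> carrier_mat (n k) (n k)" for c k using carrier by (simp add: \<phi>'_def)
  have \<phi>'cong: "cong_ker \<omega> n (\<phi>' c) (\<phi> c)" for c
    using cong_ker_sym[OF one] cong_ker_refl[of "\<phi> c" n] carrier
    by (cases "c = 1") (simp_all add: \<phi>'_def[abs_def])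
  define \<psi> where "\<psi> a k = mat (n k) (n k) (\<lambda>(i, j). \<Sum>c\<in>C. representation C a c * \<phi>' c k $$ (i, j))" for a k
  have \<psi>c: "\<psi> a k \<in> carrier_mat (n k) (n k)" for a k by (simp add: \<psi>_def)
  have \<psi>add: "\<psi> (a + b) k = \<psi> a k + \<psi> b k" if "a \<in> span C" "b \<in> span C" for a b k
    unfolding \<psi>_def representation_add[OF C(3) that(2,1)]
    by (intro eq_matI) (auto simp: distrib_right sum.distrib)
  have \<psi>smult: "\<psi> (scale c a) k = c \<cdot>\<^sub>m \<psi> a k" if "a \<in> span C" for a c k
    unfolding \<psi>_def representation_scale[OF C(3) that]
    by (intro eq_matI) (auto simp: sum_distrib_left mult.assoc)
  have \<psi>basis: "\<psi> c k = \<phi>' c k" if "c \<in> C" for c k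
    unfolding \<psi>_def representation_basis[OF C(3) that] using that finC \<phi>'c[of c k]
    by (intro eq_matI) (auto simp: if_distrib[of "\<lambda>x. x * _"] sum.delta cong: if_cong)
  have \<psi>one: "\<psi> 1 k = 1\<^sub>m (n k)" for k using \<psi>basis[of 1 k] C(1) by (simp add: \<phi>'_def)
  have \<psi>zero: "\<psi> 0 k = 0\<^sub>m (n k) (n k)" for k
    using \<psi>smult[OF span_zero, of 0 k] zero_smult_carrier_mat[OF \<psi>c[of 0 k]] by (simp only: scale_zero_right)
  have smult_cong: "cong_ker \<omega> n (\<psi> (scale c a)) (\<phi> (scale c a))"
    if "a \<in> span C" "cong_ker \<omega> n (\<psi> a) (\<phi> a)" for c a
    using cong_ker_trans[OF cong_ker_smult[OF that(2)] cong_ker_sym[OF smult], of c]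
    by (simp only: ext[of "\<psi> (scale c a)", OF \<psi>smult[OF that(1)]])
  have add_cong: "cong_ker \<omega> n (\<psi> (a + b)) (\<phi> (a + b))"
    if "a \<in> span C" "cong_ker \<omega> n (\<psi> a) (\<phi> a)" "b \<in> span C" "cong_ker \<omega> n (\<psi> b) (\<phi> b)" for a b
    using cong_ker_trans[OF cong_ker_add[OF that(2,4)] cong_ker_sym[OF add]]
    by (simp only: ext[of "\<psi> (a + b)", OF \<psi>add[OF that(1,3)]])
  have basis_cong: "cong_ker \<omega> n (\<psi> c) (\<phi> c)" if "c \<in> C" for c
    using \<phi>'cong[of c] by (simp only: ext[of "\<psi> c", OF \<psi>basis[OF that]])
  have cong: "cong_ker \<omega> n (\<psi> a) (\<phi> a)" if "a \<in> span C" for a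
  proof -
    have "a \<in> span C \<and> cong_ker \<omega> n (\<psi> a) (\<phi> a)" using that
    proof (induction rule: span_induct_alt)
      case base
      show ?case using smult_cong[OF _ basis_cong[of 1], of 0] C(1) by (auto simp: span_zero span_base)
    next
      case (step c x y)
      then show ?case using smult_cong[OF span_base basis_cong] add_cong
        by (simp add: span_add span_scale span_base)
    qed
    then show ?thesis ..
  qed
  \<comment> \<open>The multiplicative defects on pairs of generators. There are finitely many, so
    along \<omega> they are small simultaneously.\<close>
  define D where "D p k = \<psi> (fst p * snd p) k - \<psi> (fst p) k * \<psi> (snd p) k" for p k
  have Dc: "D p k \<in> carrier_mat (n k) (n k)" for p k
    unfolding D_def using mult_carrier_mat[OF \<psi>c \<psi>c] by (rule minus_carrier_mat)
  have Dker: "in_ker_rho \<omega> (D p)" if "p \<in> B \<times> B" for p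
  proof -
    obtain x y where p: "p = (x, y)" "x \<in> B" "y \<in> B" using \<open>p \<in> B \<times> B\<close> by auto
    have xy: "x \<in> span C" "y \<in> span C" using p BC span_base by auto
    have "cong_ker \<omega> n (\<psi> (x * y)) (\<lambda>k. \<psi> x k * \<psi> y k)"
      using cong_ker_trans[OF cong_ker_trans[OF cong[OF prodC[OF p(2,3)]] mult]
          cong_ker_sym[OF cong_ker_mult[OF cong[OF xy(1)] cong[OF xy(2)]]]] .
    then show ?thesis unfolding D_def p by (simp add: cong_ker_def)
  qed
  let ?N = "card (B \<times> B)"
  \<comment> \<open>The ranks of the \<open>?N\<close> defects then add up to at most
    \<open>?N\<close> times \<epsilon>' times \<open>n k\<close>. The extra 1 makes the final bound
    strict and the denominator positive.\<close>
  define \<epsilon>' where "\<epsilon>' = \<epsilon> / (real ?N + 1)"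
  have \<epsilon>': "\<epsilon>' > 0" using \<epsilon> by (simp add: \<epsilon>'_def add_nonneg_pos)
  have "eventually (\<lambda>k. \<forall>p\<in>B \<times> B. rho (D p k) < \<epsilon>') \<omega>"
    using B(1) order_tendstoD(2)[OF Dker[unfolded in_ker_rho_def] \<epsilon>']
    by (intro eventually_ball_finite) auto
  then have "eventually (\<lambda>k. almost_rep scale (span B) \<epsilon> (n k) (\<lambda>a. \<psi> a k)) \<omega>"
    using pos
  proof eventually_elim
    case (elim k)
    \<comment> \<open>The columns of \<open>Q\<close> span a large space on which all defects vanish
      at once.\<close>
    obtain Q d where Q: "inj_mat Q (n k) d" "\<And>p. p \<in> B \<times> B \<Longrightarrow> D p k * Q = 0\<^sub>m (n k) d"
      "n k \<le> d + (\<Sum>p\<in>B \<times> B. vec_space.rank (n k) (D p k))"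
      using inj_mat_annihilating[of "B \<times> B" "\<lambda>p. D p k" "n k"] B(1) Dc by auto
    note Qc = inj_mat_carrier[OF Q(1)]
    have "real (vec_space.rank (n k) (D p k)) \<le> \<epsilon>' * real (n k)" if "p \<in> B \<times> B" for p
    proof -
      have "rho (D p k) < \<epsilon>'" using elim(1) that by blast
      then show ?thesis using elim(2) unfolding rho_eq[OF Dc] by (simp add: pos_divide_less_eq)
    qed
    then have "(\<Sum>p\<in>B \<times> B. real (vec_space.rank (n k) (D p k))) \<le> real ?N * (\<epsilon>' * real (n k))"
      by (rule sum_bounded_above)
    also have "\<dots> < (real ?N + 1) * (\<epsilon>' * real (n k))" using \<epsilon>' elim by (simp add: distrib_right)
    also have "\<dots> = \<epsilon> * real (n k)" unfolding \<epsilon>'_def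
      using add_nonneg_pos[of "real ?N" 1] by simp
    finally have small: "real (n k) - real d < \<epsilon> * real (n k)"
      using of_nat_mono[OF Q(3), where 'a = real] by simp
    have gen: "x * y \<in> span C \<and> \<psi> x k * \<psi> y k * Q = \<psi> (x * y) k * Q" if "x \<in> B" "y \<in> B" for x y
    proof -
      have "0\<^sub>m (n k) d = (\<psi> (x * y) k - \<psi> x k * \<psi> y k) * Q" using Q(2)[of "(x, y)"] that by (simp add: D_def)
      also have "\<dots> = \<psi> (x * y) k * Q - \<psi> x k * \<psi> y k * Q"
        using \<psi>c mult_carrier_mat[OF \<psi>c \<psi>c] Qc by (rule minus_mult_distrib_mat)
      finally have z: "\<psi> (x * y) k * Q - \<psi> x k * \<psi> y k * Q = 0\<^sub>m (n k) d" ..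
      have "\<psi> (x * y) k * Q \<in> carrier_mat (n k) d" "\<psi> x k * \<psi> y k * Q \<in> carrier_mat (n k) d"
        using \<psi>c mult_carrier_mat[OF \<psi>c \<psi>c] Qc by (auto intro: mult_carrier_mat)
      with z have "\<psi> x k * \<psi> y k * Q = \<psi> (x * y) k * Q"
        using eq_of_minus_mat_eq_zero by metis
      then show ?thesis using prodC that by blast
    qed
    \<comment> \<open>Multiplicativity on \<open>Q\<close> extends from generators to the span
      bilinearly, first in the left and then in the right factor. Membership in
      \<open>span C\<close> is carried along because linearity of \<psi> was established only
      there.\<close>
    have left: "x * y \<in> span C \<and> \<psi> x k * \<psi> y k * Q = \<psi> (x * y) k * Q" if "x \<in> span B" "y \<in> B" for x y
    proof -
      have yC: "y \<in> span C" using that BC span_base by auto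
      have "x \<in> span C \<and> x * y \<in> span C \<and> \<psi> x k * \<psi> y k * Q = \<psi> (x * y) k * Q" using that(1)
      proof (induction rule: span_induct_alt)
        case base
        show ?case using \<psi>c[of y k] Qc by (simp add: span_zero \<psi>zero)
      next
        case (step c z x)
        have z: "z \<in> span C" "z * y \<in> span C" "\<psi> z k * \<psi> y k * Q = \<psi> (z * y) k * Q"
          using gen[OF step(1) that(2)] step(1) BC span_base by auto
        have e: "(scale c z + x) * y = scale c (z * y) + x * y" by (simp add: distrib_right scale_mult)
        have "\<psi> (scale c z + x) k * \<psi> y k * Q = c \<cdot>\<^sub>m (\<psi> z k * \<psi> y k * Q) + \<psi> x k * \<psi> y k * Q"
          using z(1) step \<psi>c[of z k] \<psi>c[of x k] \<psi>c[of y k] Qc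
          by (simp add: \<psi>add \<psi>smult span_scale add_mult_distrib_mat[of _ "n k" "n k"] mult_smult_assoc_mat[of _ "n k" "n k"])
        also have "\<dots> = \<psi> ((scale c z + x) * y) k * Q"
          unfolding e z(3) using z(2) step \<psi>c[of "z * y" k] \<psi>c[of "x * y" k] Qc
          by (simp add: \<psi>add \<psi>smult span_scale add_mult_distrib_mat[of _ "n k" "n k"] mult_smult_assoc_mat[of _ "n k" "n k"])
        finally show ?case using z step e by (simp add: span_add span_scale)
      qed
      then show ?thesis by blast
    qed
    have full: "x * y \<in> span C \<and> \<psi> x k * \<psi> y k * Q = \<psi> (x * y) k * Q" if "x \<in> span B" "y \<in> span B" for x y
    proof -
      have xC: "x \<in> span C" using that BC by auto
      have "y \<in> span C \<and> x * y \<in> span C \<and> \<psi> x k * \<psi> y k * Q = \<psi> (x * y) k * Q" using that(2)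
      proof (induction rule: span_induct_alt)
        case base
        show ?case using \<psi>c[of x k] Qc by (simp add: span_zero \<psi>zero)
      next
        case (step c z y)
        have z: "z \<in> span C" "x * z \<in> span C" "\<psi> x k * \<psi> z k * Q = \<psi> (x * z) k * Q"
          using left[OF that(1) step(1)] step(1) BC span_base by auto
        have e: "x * (scale c z + y) = scale c (x * z) + x * y"
          by (simp add: distrib_left scale_mult(2))
        have "\<psi> x k * \<psi> (scale c z + y) k * Q = c \<cdot>\<^sub>m (\<psi> x k * \<psi> z k * Q) + \<psi> x k * \<psi> y k * Q"
        proof -
          have "\<psi> x k * \<psi> (scale c z + y) k = c \<cdot>\<^sub>m (\<psi> x k * \<psi> z k) + \<psi> x k * \<psi> y k"
            using z(1) step \<psi>c[of x k] \<psi>c[of z k] \<psi>c[of y k]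
            by (simp add: \<psi>add \<psi>smult span_scale mult_add_distrib_mat[of _ "n k" "n k" _ "n k"]
                mult_smult_distrib[of _ "n k" "n k" _ "n k"])
          then show ?thesis
            using mult_carrier_mat[OF \<psi>c[of x k] \<psi>c[of z k]] mult_carrier_mat[OF \<psi>c[of x k] \<psi>c[of y k]] Qc
            by (simp add: add_mult_distrib_mat[of _ "n k" "n k" _ _ d] mult_smult_assoc_mat[of _ "n k" "n k" _ d])
        qed
        also have "\<dots> = \<psi> (x * (scale c z + y)) k * Q"
          unfolding e z(3) using z(2) step \<psi>c[of "x * z" k] \<psi>c[of "x * y" k] Qc
          by (simp add: \<psi>add \<psi>smult span_scale add_mult_distrib_mat[of _ "n k" "n k"] mult_smult_assoc_mat[of _ "n k" "n k"])
        finally show ?case using z step e by (simp add: span_add span_scale)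
      qed
      then show ?thesis by blast
    qed
    show ?case
      using BC by (intro almost_repI[OF _ _ _ _ Q(1) small]) (auto simp: \<psi>c \<psi>one \<psi>add \<psi>smult full subset_iff)
  qed
  then show ?thesis using that[of \<psi>] cong BC by blast
qed

lemma has_afd_reps: "has_afd_reps scale"
  unfolding has_afd_reps_def
proof (intro allI impI)
  fix L \<epsilon> assume "fin_dim_subspace scale L \<and> 1 \<in> L" "(0::real) < \<epsilon>"
  then obtain B where B: "finite B" "L = span B" "1 \<in> span B" by (auto simp: fin_dim_subspace_def)
  obtain \<psi> where "eventually (\<lambda>k. almost_rep scale (span B) \<epsilon> (n k) (\<lambda>a. \<psi> a k)) \<omega>"
    using almost_reps_of_span[OF B(1,3) \<open>0 < \<epsilon>\<close>] by blast
  then show "\<exists>m \<psi>. almost_rep scale L \<epsilon> m (\<psi> :: 'a \<Rightarrow> 'f mat)"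
    using eventually_happens'[OF ne_bot] B(2) by blast
qed

text \<open>On \<open>p\<close> the corrected map differs from \<phi> by small rank along \<omega>,
  and its own rank is small because it is an almost representation and \<open>p\<close> is in the
  radical. Each contributes at most half of \<open>e\<close>.\<close>

lemma in_ker_rho_of_mem_sofic_radical:
  assumes p: "p \<in> sofic_radical scale" shows "in_ker_rho \<omega> (\<phi> p)"
  unfolding in_ker_rho_def
proof (rule order_tendstoI)
  fix e :: real assume e: "0 < e"
  have "\<forall>\<delta>>0. \<exists>L \<eta>. fin_dim_subspace scale L \<and> 1 \<in> L \<and> p \<in> L \<and> \<eta> > 0 \<and>
               (\<forall>\<epsilon> m \<psi>. 0 < \<epsilon> \<and> \<epsilon> < \<eta> \<and> almost_rep scale L \<epsilon> m \<psi> \<longrightarrow>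
                  real (vec_space.rank m (\<psi> p :: 'f mat)) < \<delta> * real m)"
    using p has_afd_reps unfolding sofic_radical_def by simp
  from this[rule_format, of "e / 2"] e
  obtain L \<eta> where L: "fin_dim_subspace scale L" "1 \<in> L" "p \<in> L" "\<eta> > 0"
    and small: "\<And>\<epsilon> m \<psi>. 0 < \<epsilon> \<Longrightarrow> \<epsilon> < \<eta> \<Longrightarrow> almost_rep scale L \<epsilon> m \<psi> \<Longrightarrow>
        real (vec_space.rank m (\<psi> p :: 'f mat)) < e / 2 * real m"
    by (metis half_gt_zero)
  obtain B where B: "finite B" "L = span B" using L(1) by (auto simp: fin_dim_subspace_def)
  \<comment> \<open>The radical condition requires an accuracy strictly between 0 and
    \<eta>.\<close>
  obtain \<psi> where cong: "\<And>a. a \<in> span B \<Longrightarrow> cong_ker \<omega> n (\<psi> a) (\<phi> a)"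
    and rep: "eventually (\<lambda>k. almost_rep scale (span B) (\<eta> / 2) (n k) (\<lambda>a. \<psi> a k)) \<omega>"
    using almost_reps_of_span[OF B(1), of "\<eta> / 2"] L B(2) by auto
  have "cong_ker \<omega> n (\<phi> p) (\<psi> p)" using cong L(3) B(2) cong_ker_sym by blast
  then have c: "\<psi> p k \<in> carrier_mat (n k) (n k)" and "in_ker_rho \<omega> (\<lambda>k. \<phi> p k - \<psi> p k)" for k
    by (auto simp: cong_ker_def)
  then have "eventually (\<lambda>k. rho (\<phi> p k - \<psi> p k) < e / 2) \<omega>"
    using order_tendstoD(2)[of _ 0 \<omega> "e / 2"] e by (auto simp: in_ker_rho_def)
  then show "eventually (\<lambda>k. rho (\<phi> p k) < e) \<omega>" using rep pos
  proof eventually_elim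
    case (elim k)
    have "real (vec_space.rank (n k) (\<psi> p k)) < e / 2 * real (n k)"
      using small[OF _ _ elim(2)[folded B(2)]] L(4) by simp
    then have "rho (\<psi> p k) < e / 2" using rho_eq[OF c[of k]] elim(3) by (simp add: pos_divide_less_eq)
    moreover have "\<phi> p k = (\<phi> p k - \<psi> p k) + \<psi> p k"
      using c[of k] carrier[of p k] by (intro eq_matI) auto
    then have "rho (\<phi> p k) \<le> rho (\<phi> p k - \<psi> p k) + rho (\<psi> p k)"
      using rho_add_le[of "\<phi> p k - \<psi> p k" "n k" "\<psi> p k"] c[of k] by (simp add: minus_carrier_mat)
    ultimately show ?case using elim(1) by linarith
  qed
next
  fix e :: real assume "e < 0"
  then show "eventually (\<lambda>k. e < rho (\<phi> p k)) \<omega>"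
    by (intro always_eventually allI) (rule less_le_trans[OF _ rho_nonneg])
qed

end

lemma sofic_radical_eq_zero_of_linear_sofic:
  fixes scale :: "'f::field \<Rightarrow> 'a::ring_1 \<Rightarrow> 'a"
  assumes alg: "f_algebra scale" and "linear_sofic scale"
  shows "sofic_radical scale = {0}"
proof -
  obtain \<omega> n and \<phi> :: "'a \<Rightarrow> nat \<Rightarrow> 'f mat"
    where \<omega>: "nonprincipal_ultrafilter \<omega>" and n: "filterlim n at_top sequentially"
      and c: "\<And>a k. \<phi> a k \<in> carrier_mat (n k) (n k)"
      and h: "in_ker_rho \<omega> (\<lambda>k. \<phi> 1 k - 1\<^sub>m (n k))"
        "\<And>a b. in_ker_rho \<omega> (\<lambda>k. \<phi> (a + b) k - (\<phi> a k + \<phi> b k))"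
        "\<And>c a. in_ker_rho \<omega> (\<lambda>k. \<phi> (scale c a) k - c \<cdot>\<^sub>m \<phi> a k)"
        "\<And>a b. in_ker_rho \<omega> (\<lambda>k. \<phi> (a * b) k - \<phi> a k * \<phi> b k)"
      and inj: "\<And>a. in_ker_rho \<omega> (\<phi> a) \<Longrightarrow> a = 0"
    using assms(2) unfolding linear_sofic_def by (elim exE conjE) (rule that, auto)
  have "eventually (\<lambda>k. 0 < n k) sequentially"
    by (rule eventually_compose_filterlim[OF eventually_gt_at_top n])
  then have pos: "eventually (\<lambda>k. 0 < n k) \<omega>"
    by (rule filter_leD[OF nonprincipal_ultrafilter_le_sequentially[OF \<omega>]])
  interpret vector_space scale using alg by (simp add: f_algebra_def)
  interpret sofic_approximation scale \<omega> n \<phi>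
    using alg \<omega> pos c h by unfold_locales
      (auto simp: nonprincipal_ultrafilter_def cong_ker_def intro: mult_carrier_mat)
  have "p = 0" if "p \<in> sofic_radical scale" for p
    by (rule inj[OF in_ker_rho_of_mem_sofic_radical[OF that]])
  then show ?thesis using zero_in_sofic_radical[OF alg] by (intro equalityI subsetI) simp_all
qed

section \<open>From a trivial sofic radical to linear soficity\<close>

lemma almost_rep_mono:
  assumes "almost_rep scale L \<epsilon> m \<psi>" "\<epsilon> \<le> \<epsilon>'" shows "almost_rep scale L \<epsilon>' m \<psi>"
proof -
  have "\<epsilon> * real m \<le> \<epsilon>' * real m" using assms(2) by (intro mult_right_mono) auto
  then show ?thesis using assms(1) unfolding almost_rep_def by (meson less_le_trans)
qed

text \<open>Further copies make the dimension at least \<open>N\<close> without lowering rank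
  ratios; this provides matrix sizes that tend to infinity.\<close>

lemma almost_rep_weighted_sum_large:
  fixes \<psi> :: "nat \<Rightarrow> 'a::ring_1 \<Rightarrow> 'f::field mat"
  assumes "\<And>i. i \<le> k \<Longrightarrow> almost_rep scale L \<epsilon> (m i) (\<psi> i)"
  shows "\<exists>M \<chi>. N \<le> M \<and> almost_rep scale L \<epsilon> M \<chi> \<and>
     (\<forall>i\<le>k. \<forall>a\<in>L. rho (\<psi> i a) \<le> 2 ^ Suc i * rho (\<chi> a))"
proof -
  obtain M \<chi> where M: "almost_rep scale L \<epsilon> M \<chi>"
    "\<And>i a. i \<le> k \<Longrightarrow> a \<in> L \<Longrightarrow> real (vec_space.rank (m i) (\<psi> i a)) / real (m i)
        \<le> 2 ^ Suc i * (real (vec_space.rank M (\<chi> a)) / real M)"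
    using almost_rep_weighted_sum[of k scale L \<epsilon> m \<psi>, OF assms] by auto
  obtain \<chi>' where \<chi>': "almost_rep scale L \<epsilon> (Suc N * M) \<chi>'"
    "\<And>a. a \<in> L \<Longrightarrow> Suc N * vec_space.rank M (\<chi> a) \<le> vec_space.rank (Suc N * M) (\<chi>' a)"
    using almost_rep_copies[OF M(1), of N] by auto
  have pos: "0 < M" by (rule almost_rep_pos_dim[OF M(1)])
  have "rho (\<psi> i a) \<le> 2 ^ Suc i * rho (\<chi>' a)" if "i \<le> k" "a \<in> L" for i a
  proof -
    have c: "\<psi> i a \<in> carrier_mat (m i) (m i)" "\<chi>' a \<in> carrier_mat (Suc N * M) (Suc N * M)"
      using assms[OF that(1)] \<chi>'(1) that(2) by (auto simp: almost_rep_def)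
    have "real (vec_space.rank M (\<chi> a)) / real M = real (Suc N * vec_space.rank M (\<chi> a)) / real (Suc N * M)"
      unfolding of_nat_mult by (rule mult_divide_mult_cancel_left[symmetric]) simp
    also have "\<dots> \<le> rho (\<chi>' a)"
      unfolding rho_eq[OF c(2)] using \<chi>'(2)[OF that(2)] by (intro divide_right_mono of_nat_mono) auto
    finally have "2 ^ Suc i * (real (vec_space.rank M (\<chi> a)) / real M) \<le> 2 ^ Suc i * rho (\<chi>' a)"
      by (intro mult_left_mono) auto
    then show ?thesis using M(2)[OF that] unfolding rho_eq[OF c(1)] by linarith
  qed
  moreover have "N \<le> Suc N * M" using pos by (cases M) auto
  ultimately show ?thesis using \<chi>'(1) by blast
qed

text \<open>The negated definition: one \<delta> works for all \<open>L\<close> and \<eta>. Almost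
  representations exist at all, since otherwise the radical would be the whole algebra.\<close>

lemma not_in_sofic_radicalE:
  fixes scale :: "'f::field \<Rightarrow> 'a::ring_1 \<Rightarrow> 'a"
  assumes "p \<notin> sofic_radical scale"
  obtains \<delta> where "\<delta> > 0" "\<And>L \<eta>. fin_dim_subspace scale L \<Longrightarrow> 1 \<in> L \<Longrightarrow> p \<in> L \<Longrightarrow> \<eta> > 0 \<Longrightarrow>
     \<exists>m \<psi>. almost_rep scale L \<eta> m (\<psi> :: 'a \<Rightarrow> 'f mat) \<and> \<delta> \<le> rho (\<psi> p)"
proof -
  have "has_afd_reps scale" using assms unfolding sofic_radical_def by (auto split: if_splits)
  then obtain \<delta> where \<delta>: "\<delta> > 0"
    and ex: "\<And>L \<eta>. fin_dim_subspace scale L \<Longrightarrow> 1 \<in> L \<Longrightarrow> p \<in> L \<Longrightarrow> \<eta> > 0 \<Longrightarrow>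
      \<exists>\<epsilon> m \<psi>. 0 < \<epsilon> \<and> \<epsilon> < \<eta> \<and> almost_rep scale L \<epsilon> m \<psi> \<and>
        \<not> real (vec_space.rank m (\<psi> p :: 'f mat)) < \<delta> * real m"
    using assms unfolding sofic_radical_def by auto
  show ?thesis
  proof (rule that[OF \<delta>])
    fix L and \<eta> :: real
    assume *: "fin_dim_subspace scale L" "1 \<in> L" "p \<in> L" "\<eta> > 0"
    obtain \<epsilon> m and \<psi> :: "'a \<Rightarrow> 'f mat" where r: "\<epsilon> < \<eta>" "almost_rep scale L \<epsilon> m \<psi>"
      "\<not> real (vec_space.rank m (\<psi> p)) < \<delta> * real m"
      using ex[OF *] by blast
    have "\<psi> p \<in> carrier_mat m m" using r(2) *(3) by (simp add: almost_rep_def)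
    then have "\<delta> \<le> rho (\<psi> p)"
      using r(3) almost_rep_pos_dim[OF r(2)] by (simp add: rho_eq[of _ m] pos_le_divide_eq)
    then show "\<exists>m \<psi>. almost_rep scale L \<eta> m (\<psi> :: 'a \<Rightarrow> 'f mat) \<and> \<delta> \<le> rho (\<psi> p)"
      using almost_rep_mono[OF r(2)] r(1) by (meson less_imp_le)
  qed
qed

text \<open>Each element involves finitely many basis vectors, so it lies in the span of a long
  enough initial part of an enumeration. The unit is adjoined because almost representations are
  considered on spaces containing 1.\<close>

lemma countable_dim_filtration:
  fixes scale :: "'f::field \<Rightarrow> 'a::ring_1 \<Rightarrow> 'a"
  assumes vs: "vector_space scale" and "countable_dim scale"
  obtains G :: "nat \<Rightarrow> 'a set" where "\<And>k. finite (G k)" "\<And>k. 1 \<in> G k"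
    "\<And>a. eventually (\<lambda>k. a \<in> module.span scale (G k)) sequentially"
proof -
  interpret vector_space scale by (rule vs)
  obtain B where B: "countable B" "span B = UNIV" using assms(2) by (auto simp: countable_dim_def)
  define e where "e = from_nat_into (insert 1 B)"
  define G where "G k = insert 1 (e ` {..k})" for k :: nat
  have "eventually (\<lambda>k. a \<in> span (G k)) sequentially" for a
  proof -
    have "a \<in> span B" using B(2) by simp
    then show ?thesis
    proof (induction rule: span_induct_alt)
      case (step c x y)
      obtain i where "e i = x"
        using from_nat_into_surj[of "insert 1 B" x] B(1) step(1) by (auto simp: e_def)
      then have "eventually (\<lambda>k. x \<in> span (G k)) sequentially"
        by (intro eventually_mono[OF eventually_ge_at_top[of i]] span_base) (auto simp: G_def)
      then show ?case using step(2) by eventually_elim (simp add: span_add span_scale)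
    qed (simp add: span_zero)
  qed
  then show ?thesis using that[of G] by (simp add: G_def)
qed

text \<open>The almost representations of an exhausting sequence form a morphism in the limit: it is
  linear exactly once the elements lie in \<open>L k\<close>, and multiplicative up to normalised
  rank \<open>1 / (k + 1)\<close>.\<close>

lemma linear_sofic_of_separating_almost_reps:
  fixes scale :: "'f::field \<Rightarrow> 'a::ring_1 \<Rightarrow> 'a"
  assumes vs: "vector_space scale" and \<omega>: "nonprincipal_ultrafilter \<omega>"
    and one: "\<And>k. 1 \<in> L k" and sub: "\<And>k. module.subspace scale (L k)"
    and ev: "\<And>a. eventually (\<lambda>k. a \<in> L k) \<omega>"
    and rep: "\<And>k. almost_rep scale (L k) (inverse (real (Suc k))) (m k) (\<chi> k :: 'a \<Rightarrow> 'f mat)"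
    and large: "\<And>k. k \<le> m k"
    and sep: "\<And>a. in_ker_rho \<omega> (\<lambda>k. \<chi> k a) \<Longrightarrow> a = 0"
  shows "linear_sofic scale"
proof -
  interpret vector_space scale by (rule vs)
  \<comment> \<open>The value 0 outside \<open>L k\<close> only supplies a total function; each
    \<open>a\<close> lies in \<open>L k\<close> along \<omega>.\<close>
  define \<phi> where "\<phi> a k = (if a \<in> L k then \<chi> k a else 0\<^sub>m (m k) (m k))" for a k
  have c: "\<phi> a k \<in> carrier_mat (m k) (m k)" for a k
    using rep[of k] by (auto simp: \<phi>_def almost_rep_def)
  have lin: "\<chi> k (a + b) = \<chi> k a + \<chi> k b" "\<chi> k (scale t a) = t \<cdot>\<^sub>m \<chi> k a"
    if "a \<in> L k" "b \<in> L k" for a b k t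
    using rep[of k] that unfolding almost_rep_def by blast+
  have small: "((\<lambda>k. inverse (real (Suc k))) \<longlongrightarrow> 0) \<omega>"
    using tendsto_mono[OF nonprincipal_ultrafilter_le_sequentially[OF \<omega>] LIMSEQ_inverse_real_of_nat] .
  show ?thesis unfolding linear_sofic_def
  proof (intro exI conjI allI impI)
    show "nonprincipal_ultrafilter \<omega>" by (rule \<omega>)
    show "filterlim m at_top sequentially"
      using large by (intro filterlim_at_top_mono[OF filterlim_ident]) auto
    show "\<phi> a k \<in> carrier_mat (m k) (m k)" for a k by (rule c)
    show "in_ker_rho \<omega> (\<lambda>k. \<phi> 1 k - 1\<^sub>m (m k))"
    proof (intro in_ker_rho_eventually_zero always_eventually allI)
      fix k
      have "\<phi> 1 k = 1\<^sub>m (m k)" using one rep[of k] by (simp add: \<phi>_def almost_rep_def)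
      then show "rho (\<phi> 1 k - 1\<^sub>m (m k)) = 0" by (simp only: rho_minus_self[OF one_carrier_mat])
    qed
    show "in_ker_rho \<omega> (\<lambda>k. \<phi> (a + b) k - (\<phi> a k + \<phi> b k))" for a b
    proof (rule in_ker_rho_eventually_zero)
      show "eventually (\<lambda>k. rho (\<phi> (a + b) k - (\<phi> a k + \<phi> b k)) = 0) \<omega>"
        using ev[of a] ev[of b]
      proof eventually_elim
        case (elim k)
        have "a + b \<in> L k" by (rule subspace_add[OF sub elim])
        then have "\<phi> (a + b) k = \<phi> a k + \<phi> b k" using elim lin(1) by (simp add: \<phi>_def)
        then show ?case using rho_minus_self[OF c[of "a + b" k]] by (simp only:)
      qed
    qed
    show "in_ker_rho \<omega> (\<lambda>k. \<phi> (scale t a) k - t \<cdot>\<^sub>m \<phi> a k)" for t a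
    proof (rule in_ker_rho_eventually_zero)
      show "eventually (\<lambda>k. rho (\<phi> (scale t a) k - t \<cdot>\<^sub>m \<phi> a k) = 0) \<omega>"
        using ev[of a]
      proof eventually_elim
        case (elim k)
        have "scale t a \<in> L k" by (rule subspace_scale[OF sub elim])
        then have "\<phi> (scale t a) k = t \<cdot>\<^sub>m \<phi> a k" using elim lin(2) by (simp add: \<phi>_def)
        then show ?case using rho_minus_self[OF c[of "scale t a" k]] by (simp only:)
      qed
    qed
    show "in_ker_rho \<omega> (\<lambda>k. \<phi> (a * b) k - \<phi> a k * \<phi> b k)" for a b
      unfolding in_ker_rho_def
    proof (rule tendsto_sandwich[OF _ _ tendsto_const small])
      show "eventually (\<lambda>k. 0 \<le> rho (\<phi> (a * b) k - \<phi> a k * \<phi> b k)) \<omega>"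
        by (intro always_eventually allI rho_nonneg)
      show "eventually (\<lambda>k. rho (\<phi> (a * b) k - \<phi> a k * \<phi> b k) \<le> inverse (real (Suc k))) \<omega>"
        using ev[of a] ev[of b] ev[of "a * b"]
      proof eventually_elim
        case (elim k)
        have d: "\<phi> (a * b) k - \<phi> a k * \<phi> b k \<in> carrier_mat (m k) (m k)"
          using mult_carrier_mat[OF c c] by (rule minus_carrier_mat)
        have "real (vec_space.rank (m k) (\<phi> (a * b) k - \<phi> a k * \<phi> b k)) < inverse (real (Suc k)) * real (m k)"
          using almost_rep_rank_defect[OF rep elim] elim by (simp add: \<phi>_def)
        then show ?case unfolding rho_eq[OF d]
          using almost_rep_pos_dim[OF rep[of k]] by (simp add: pos_divide_le_eq)
      qed
    qed
    fix a assume "in_ker_rho \<omega> (\<phi> a)"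
    then have "in_ker_rho \<omega> (\<lambda>k. \<chi> k a)"
      by (rule in_ker_rho_mono) (use ev[of a] in \<open>auto elim!: eventually_mono simp: \<phi>_def\<close>)
    then show "a = 0" by (rule sep)
  qed
qed

lemma linear_sofic_of_sofic_radical_eq_zero:
  fixes scale :: "'f::field \<Rightarrow> 'a::ring_1 \<Rightarrow> 'a"
  assumes alg: "f_algebra scale" and dim: "countable_dim scale" and SR: "sofic_radical scale = {0}"
  shows "linear_sofic scale"
proof -
  have vs: "vector_space scale" using alg by (simp add: f_algebra_def)
  interpret vector_space scale by (rule vs)
  \<comment> \<open>Otherwise the radical would be the whole algebra, which contains 1, and 1
    differs from 0.\<close>
  have afd: "has_afd_reps scale"
  proof (rule ccontr)
    assume "\<not> has_afd_reps scale"
    then have "(1 :: 'a) \<in> {0}" using SR unfolding sofic_radical_def by auto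
    then show False by simp
  qed
  obtain \<omega> where \<omega>: "nonprincipal_ultrafilter \<omega>" using nonprincipal_ultrafilter_exists by blast
  then have nb: "\<omega> \<noteq> bot" by (simp add: nonprincipal_ultrafilter_def)
  obtain G :: "nat \<Rightarrow> 'a set" where G: "\<And>k. finite (G k)" "\<And>k. 1 \<in> G k"
    "\<And>a. eventually (\<lambda>k. a \<in> span (G k)) sequentially"
    using countable_dim_filtration[OF vs dim] by blast
  have one: "1 \<in> span (G k)" for k using G(2) by (rule span_base)
  have fd: "fin_dim_subspace scale (span (G k))" for k using G(1) by (auto simp: fin_dim_subspace_def)
  have ev: "eventually (\<lambda>k. a \<in> span (G k)) \<omega>" for a
    by (rule filter_leD[OF nonprincipal_ultrafilter_le_sequentially[OF \<omega>] G(3)])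
  let ?\<epsilon> = "\<lambda>k. inverse (real (Suc k))"
  have "\<exists>\<delta> m \<psi>. p \<noteq> 0 \<longrightarrow> 0 < \<delta> \<and> (\<forall>k. almost_rep scale (span (G k)) (?\<epsilon> k) (m k) (\<psi> k :: 'a \<Rightarrow> 'f mat) \<and>
      (p \<in> span (G k) \<longrightarrow> \<delta> \<le> rho (\<psi> k p)))" for p
  proof (cases "p = 0")
    case False
    then have "p \<notin> sofic_radical scale" using SR by simp
    then obtain \<delta> where \<delta>: "\<delta> > 0" "\<And>L \<eta>. fin_dim_subspace scale L \<Longrightarrow> 1 \<in> L \<Longrightarrow> p \<in> L \<Longrightarrow> \<eta> > 0 \<Longrightarrow>
       \<exists>m \<psi>. almost_rep scale L \<eta> m (\<psi> :: 'a \<Rightarrow> 'f mat) \<and> \<delta> \<le> rho (\<psi> p)"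
      by (rule not_in_sofic_radicalE) blast
    have "\<exists>m \<psi>. almost_rep scale (span (G k)) (?\<epsilon> k) m (\<psi> :: 'a \<Rightarrow> 'f mat) \<and>
      (p \<in> span (G k) \<longrightarrow> \<delta> \<le> rho (\<psi> p))" for k
    proof (cases "p \<in> span (G k)")
      case True
      then show ?thesis using \<delta>(2)[OF fd one True, of "?\<epsilon> k"] by auto
    next
      case False
      \<comment> \<open>When \<open>p\<close> is not yet in the space, any almost representation
        fills the gap in the sequence.\<close>
      obtain m and \<psi> :: "'a \<Rightarrow> 'f mat" where "almost_rep scale (span (G k)) (?\<epsilon> k) m \<psi>"
        using afd fd one unfolding has_afd_reps_def by (meson inverse_positive_iff_positive of_nat_0_less_iff zero_less_Suc)
      then show ?thesis using False by blast
    qed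
    then obtain m and \<psi> :: "nat \<Rightarrow> 'a \<Rightarrow> 'f mat" where
      "\<And>k. almost_rep scale (span (G k)) (?\<epsilon> k) (m k) (\<psi> k) \<and> (p \<in> span (G k) \<longrightarrow> \<delta> \<le> rho (\<psi> k p))"
      by metis
    then show ?thesis using \<delta>(1) by blast
  qed simp
  then obtain \<delta> m and \<psi> :: "'a \<Rightarrow> nat \<Rightarrow> 'a \<Rightarrow> 'f mat" where
    \<delta>: "\<And>p. p \<noteq> 0 \<Longrightarrow> 0 < \<delta> p"
    and rep: "\<And>p k. p \<noteq> 0 \<Longrightarrow> almost_rep scale (span (G k)) (?\<epsilon> k) (m p k) (\<psi> p k)"
    and big: "\<And>p k. p \<noteq> 0 \<Longrightarrow> p \<in> span (G k) \<Longrightarrow> \<delta> p \<le> rho (\<psi> p k p)"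
    by metis
  \<comment> \<open>The kernel of the limit morphism built from the almost representations attached
    to \<open>p\<close>.\<close>
  define N where "N p = {q. in_ker_rho \<omega> (\<lambda>k. \<psi> p k q)}" for p
  have N_sub: "subspace (N p)" if p: "p \<noteq> 0" for p
  proof (rule subspaceI)
    have lin: "\<psi> p k (a + b) = \<psi> p k a + \<psi> p k b" "\<psi> p k (scale t a) = t \<cdot>\<^sub>m \<psi> p k a"
       "\<psi> p k a \<in> carrier_mat (m p k) (m p k)"
      if "a \<in> span (G k)" "b \<in> span (G k)" for a b k t
      using rep[OF p, of k] that unfolding almost_rep_def by blast+
    show "0 \<in> N p" unfolding N_def
      using almost_rep_zero[OF vs rep[OF p] span_zero]
      by (auto intro!: in_ker_rho_eventually_zero simp: rho_zero)
    show "a + b \<in> N p" if "a \<in> N p" "b \<in> N p" for a b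
    proof -
      have "eventually (\<lambda>k. rho (\<psi> p k (a + b)) \<le> rho (\<psi> p k a) + rho (\<psi> p k b)) \<omega>"
        using ev[of a] ev[of b]
        by eventually_elim (simp only: lin(1), rule rho_add_le, auto intro: lin(3))
      then show ?thesis using that in_ker_rho_le[of \<omega> "\<lambda>k. \<psi> p k a" "\<lambda>k. \<psi> p k b"]
        by (simp add: N_def)
    qed
    show "scale t a \<in> N p" if "a \<in> N p" for t a
    proof -
      have "eventually (\<lambda>k. rho (\<psi> p k (scale t a)) \<le> rho (\<psi> p k a)) \<omega>"
        using ev[of a] by eventually_elim (simp only: lin(2), rule rho_smult_le, auto intro: lin(3))
      then show ?thesis using that in_ker_rho_mono[of \<omega> "\<lambda>k. \<psi> p k a"] by (simp add: N_def)
    qed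
  qed
  have notN: "p \<notin> N p" if p: "p \<noteq> 0" for p
  proof
    assume "p \<in> N p"
    then have "eventually (\<lambda>k. rho (\<psi> p k p) < \<delta> p) \<omega>"
      using order_tendstoD(2)[of _ 0 \<omega> "\<delta> p"] \<delta>[OF p] by (auto simp: N_def in_ker_rho_def)
    then have "eventually (\<lambda>k. False) \<omega>" using ev[of p]
      by eventually_elim (use big[OF p] in \<open>meson not_le\<close>)
    then show False using nb by simp
  qed
  \<comment> \<open>All nonzero \<open>p\<close> may be uncountably many; for each \<open>k\<close>
    finitely many of them already determine the intersection within
    \<open>span (G k)\<close>.\<close>
  have "\<exists>J. finite J \<and> J \<subseteq> -{0} \<and> span (G k) \<inter> \<Inter> (N ` J) \<subseteq> \<Inter> (N ` (-{0}))" for k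
    using finite_subfamily_determines_inter[OF vs G(1), of "-{0}" N k] N_sub by auto
  then obtain J where J: "\<And>k. finite (J k)" "\<And>k. J k \<subseteq> -{0}"
    "\<And>k. span (G k) \<inter> \<Inter> (N ` J k) \<subseteq> \<Inter> (N ` (-{0}))" by metis
  \<comment> \<open>The element 1 keeps \<open>K\<close> nonempty, so that every value of its
    enumeration is a nonzero element.\<close>
  define K where "K = insert 1 (\<Union>k. J k)"
  have K: "countable K" "K \<noteq> {}" "K \<subseteq> -{0}"
    unfolding K_def using J(1,2) by (auto intro: countable_finite)
  define p where "p = from_nat_into K"
  have p0: "p i \<noteq> 0" for i using from_nat_into[OF K(2), of i] K(3) by (auto simp: p_def)
  \<comment> \<open>At stage \<open>k\<close> only the first \<open>k + 1\<close> members of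
    \<open>K\<close> are combined, but for fixed \<open>i\<close> the constant
    \<open>2 ^ Suc i\<close> is the same at all stages \<open>k\<close> from \<open>i\<close>
    on.\<close>
  have "\<exists>M \<chi>. k \<le> M \<and> almost_rep scale (span (G k)) (?\<epsilon> k) M \<chi> \<and>
     (\<forall>i\<le>k. \<forall>a\<in>span (G k). rho (\<psi> (p i) k a) \<le> 2 ^ Suc i * rho (\<chi> a))" for k
    by (rule almost_rep_weighted_sum_large) (rule rep[OF p0])
  then obtain M \<chi> where M: "\<And>k. k \<le> M k" "\<And>k. almost_rep scale (span (G k)) (?\<epsilon> k) (M k) (\<chi> k)"
    "\<And>k i a. i \<le> k \<Longrightarrow> a \<in> span (G k) \<Longrightarrow> rho (\<psi> (p i) k a) \<le> 2 ^ Suc i * rho (\<chi> k a)"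
    by metis
  show ?thesis
  proof (rule linear_sofic_of_separating_almost_reps[OF vs \<omega> one subspace_span ev M(2) M(1)])
    fix a assume a: "in_ker_rho \<omega> (\<lambda>k. \<chi> k a)"
    have inN: "a \<in> N (p i)" for i
    proof -
      have lim: "((\<lambda>k. 2 ^ Suc i * rho (\<chi> k a)) \<longlongrightarrow> 0) \<omega>"
        using tendsto_mult_left[OF a[unfolded in_ker_rho_def], of "2 ^ Suc i"] by simp
      have "eventually (\<lambda>k. i \<le> k) \<omega>"
        by (rule filter_leD[OF nonprincipal_ultrafilter_le_sequentially[OF \<omega>] eventually_ge_at_top])
      then have up: "eventually (\<lambda>k. rho (\<psi> (p i) k a) \<le> 2 ^ Suc i * rho (\<chi> k a)) \<omega>"
        using ev[of a] by eventually_elim (rule M(3))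
      have low: "eventually (\<lambda>k. 0 \<le> rho (\<psi> (p i) k a)) \<omega>"
        by (intro always_eventually allI rho_nonneg)
      have "((\<lambda>k. rho (\<psi> (p i) k a)) \<longlongrightarrow> 0) \<omega>"
        by (rule tendsto_sandwich[OF low up tendsto_const lim])
      then show ?thesis by (simp add: N_def in_ker_rho_def)
    qed
    obtain k where k: "a \<in> span (G k)" using eventually_happens'[OF nb ev[of a]] by blast
    have "a \<in> N q" if "q \<in> J k" for q
    proof -
      have "q \<in> K" using that by (auto simp: K_def)
      then obtain i where "p i = q" using from_nat_into_surj[OF K(1)] by (auto simp: p_def)
      then show ?thesis using inN by blast
    qed
    \<comment> \<open>Membership in \<open>N q\<close> for \<open>q\<close> in the finite set
      \<open>J k\<close> extends to all nonzero \<open>q\<close>. Were \<open>a\<close> nonzero, it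
      would lie in its own \<open>N a\<close>, contradicting \<open>notN\<close>.\<close>
    then have "a \<in> \<Inter> (N ` (-{0}))" using J(3)[of k] k by blast
    then show "a = 0" using notN by blast
  qed
qed

theorem mainTheorem18:
  fixes scale :: "'f::field \<Rightarrow> 'a::ring_1 \<Rightarrow> 'a"
  assumes "f_algebra scale"
    and "countable_dim scale"
  shows "linear_sofic scale \<longleftrightarrow> sofic_radical scale = {0}"
  using sofic_radical_eq_zero_of_linear_sofic[OF assms(1)]
    linear_sofic_of_sofic_radical_eq_zero[OF assms] by blast

end
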